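(* Let $(A,\mathfrak m)$ be a local ring, let $N\ge 1$, let $T_0,T_1,\dots,T_N\in\mathbb C[x]\subseteq A[x]$ be non-zero polynomials, and let $S\subset\mathbb C$ be the union of their zero sets. Set $K_i=T_0^iT_1^{i-1}T_2^{i-2}\cdots T_{i-1}$ for $i=1,\dots,N+1$. Let $y_1,\dots,y_N\in A[x]$ be monic polynomials of arbitrary degree, and set $y_0=y_{N+1}=1$. For $z\in S$ and $i=1,\dots,N+1$ define $$e_i(z)=i-1+\sum_{j=0}^{i-1}\operatorname{ord}_zT_j,\qquad c_i=i-1+\deg y_i-\deg y_{i-1}+\sum_{j=0}^{i-1}\deg T_j.$$ Assume that for all $i=1,\dots,N$: - the polynomial $\bar y_i\in\mathbb C[x]$ has no multiple roots, has no roots in $S$, and is coprime to $\bar y_{i+1}$; - $y_i$ divides $\mathrm{Wr}(y_i',T_iy_{i-1}y_{i+1})$ in $A[x]$. Then there exist $u_1,\dots,u_{N+1}\in A[x]$ such that, denoting by $E_i$ the $A$-span of $u_1,\dots,u_i$, for all $i=1,\dots,N+1$: (1) $\mathrm{Wr}(u_1,\dots,u_i)=K_iy_i$; (2) $E_i\subset A[x]$ is admissible; (3) $E_i$ has ramification sequences at each $z\in S\cup\{\infty\}$; the set of exponents of $E_i$ at $z\in S$ is $\{e_1(z),\dots,e_i(z)\}$, and the set of exponents of $E_i$ at $\infty$ is $\{c_1,\dots,c_i\}$.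
   Context: A local ring $(A,\mathfrak m)$ here means a commutative Noetherian local ring containing $\mathbb C$ with residue field $A/\mathfrak m=\mathbb C$. For $f\in A[x]$, $\bar f\in\mathbb C[x]$ is its reduction modulo $\mathfrak m$. A polynomial in $A[x]$ is called monic if its leading coefficient is invertible in $A$. $A^*$ is the group of units. $\mathrm{Wr}(f_1,\dots,f_k)=\det(f_j^{(i-1)})_{i,j=1}^k$ is the Wronskian (the opposite sign convention yields an equivalent statement). $\operatorname{ord}_zT$ is the order of vanishing of $T$ at $z$. A submodule $E\subset A[x]$ is admissible of rank $r$ if it is a free $A$-module of rank $r$ and the map $E\otimes A/\mathfrak m\to\mathbb C[x]$ is injective. An admissible $E$ of rank $r$ has a ramification sequence at $z\in\mathbb C$, with set of exponents $\{b_1,\dots,b_r\}$ (distinct nonnegative integers), if $E$ has an $A$-basis $(x-z)^{b_1}f_1,\dots,(x-z)^{b_r}f_r$ with all $f_j\in A[x]$, $f_j(z)\in A^*$. It has a ramification sequence at $\infty$, with set of exponents $\{b_1,\dots,b_r\}$ (distinct nonnegative integers), if $E$ has an $A$-basis $f_1,\dots,f_r$ of monic polynomials with $\deg f_j=b_j$. (The corresponding ramification sequence $a_1\ge\dots\ge a_r\ge 0$ is determined by $\{b_j\}=\{r-j+a_j\}$ at $z\in\mathbb C$ and, for $E\subset A_d[x]$, the polynomials of degree $\le d$, by $\{b_j\}=\{d-r+j-a_j\}$ at $\infty$.) *)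

theory Defs
  imports Complex_Main "Jordan_Normal_Form.Determinant"
begin

global_interpretation ring_mod: Modules.module "(*) :: 'a::comm_ring_1 \<Rightarrow> 'a \<Rightarrow> 'a"
  by unfold_locales (simp_all add: algebra_simps)

global_interpretation poly_mod: Modules.module "smult :: 'a::comm_ring_1 \<Rightarrow> 'a poly \<Rightarrow> 'a poly"
  by unfold_locales (simp_all add: smult_add_right smult_add_left)

text \<open>Ideals are the submodules of the ring itself, \<^term>\<open>ring_mod.subspace\<close>.\<close>

definition maximal_ideal :: "'a::comm_ring_1 set \<Rightarrow> bool" where
  "maximal_ideal M \<longleftrightarrow> ring_mod.subspace M \<and> M \<noteq> UNIV \<and>
     (\<forall>I. ring_mod.subspace I \<and> M \<subseteq> I \<longrightarrow> I = M \<or> I = UNIV)"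

text \<open>
  The structure map \<open>emb\<close> is automatically injective, since the complex numbers form a field
  and \<open>1 \<noteq> 0\<close> in the ring. The last axiom says that the composite of \<open>emb\<close> with the projection
  onto the residue field is bijective; this is the identification of the residue field with
  the complex numbers.
\<close>

locale local_complex_algebra = comm_ring_hom emb
  for emb :: "complex \<Rightarrow> 'a::comm_ring_1" +
  fixes \<mm> :: "'a set"
  assumes maximal: "maximal_ideal \<mm>"
    and unique_maximal: "maximal_ideal I \<Longrightarrow> I = \<mm>"
    and noetherian: "ring_mod.subspace I \<Longrightarrow> \<exists>G. finite G \<and> I = ring_mod.span G"
    and residue_field: "\<exists>!c. a - emb c \<in> \<mm>"

definition residue :: "(complex \<Rightarrow> 'a::comm_ring_1) \<Rightarrow> 'a set \<Rightarrow> 'a \<Rightarrow> complex" where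
  "residue emb \<mm> a = (THE c. a - emb c \<in> \<mm>)"

definition reduce :: "(complex \<Rightarrow> 'a::comm_ring_1) \<Rightarrow> 'a set \<Rightarrow> 'a poly \<Rightarrow> complex poly" where
  "reduce emb \<mm> = map_poly (residue emb \<mm>)"

definition unit_monic :: "'a::comm_ring_1 poly \<Rightarrow> bool" where
  "unit_monic p \<longleftrightarrow> lead_coeff p dvd 1"

text \<open>The library's \<^const>\<open>pderiv\<close> is not available for coefficient rings with zero divisors.\<close>

definition formal_deriv :: "'a::comm_ring_1 poly \<Rightarrow> 'a poly" where
  "formal_deriv p = (\<Sum>n=1..degree p. monom (of_nat n * coeff p n) (n - 1))"

definition Wr :: "'a::comm_ring_1 poly list \<Rightarrow> 'a poly" where
  "Wr fs = det (mat (length fs) (length fs) (\<lambda>(i, j). (formal_deriv ^^ i) (fs ! j)))"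

definition is_basis :: "nat \<Rightarrow> (nat \<Rightarrow> 'a::comm_ring_1 poly) \<Rightarrow> 'a poly set \<Rightarrow> bool" where
  "is_basis r f E \<longleftrightarrow> inj_on f {1..r} \<and> \<not> poly_mod.dependent (f ` {1..r}) \<and>
     poly_mod.span (f ` {1..r}) = E"

text \<open>
  The tensor product of \<open>E\<close> with the residue field is \<open>E / \<mm>E\<close>, so the last conjunct is
  injectivity of the map that reduction induces on it.
\<close>

definition admissible ::
  "(complex \<Rightarrow> 'a::comm_ring_1) \<Rightarrow> 'a set \<Rightarrow> nat \<Rightarrow> 'a poly set \<Rightarrow> bool" where
  "admissible emb \<mm> r E \<longleftrightarrow> poly_mod.subspace E \<and> (\<exists>f. is_basis r f E) \<and>
     (\<forall>p\<in>E. \<forall>q\<in>E. reduce emb \<mm> p = reduce emb \<mm> q \<longrightarrow>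
        p - q \<in> poly_mod.span {smult a h |a h. a \<in> \<mm> \<and> h \<in> E})"

text \<open>\<open>E\<close> is admissible of rank \<open>r\<close> and has a ramification sequence at the point, with set of
  exponents \<open>B\<close>.\<close>

definition exponents_at ::
  "(complex \<Rightarrow> 'a::comm_ring_1) \<Rightarrow> 'a set \<Rightarrow> nat \<Rightarrow> 'a poly set \<Rightarrow> complex \<Rightarrow> nat set \<Rightarrow> bool" where
  "exponents_at emb \<mm> r E z B \<longleftrightarrow> admissible emb \<mm> r E \<and>
     (\<exists>b f. inj_on b {1..r} \<and> b ` {1..r} = B \<and>
        is_basis r (\<lambda>j. [:- emb z, 1:] ^ b j * f j) E \<and>
        (\<forall>j\<in>{1..r}. poly (f j) (emb z) dvd 1))"

definition exponents_at_infinity ::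
  "(complex \<Rightarrow> 'a::comm_ring_1) \<Rightarrow> 'a set \<Rightarrow> nat \<Rightarrow> 'a poly set \<Rightarrow> nat set \<Rightarrow> bool" where
  "exponents_at_infinity emb \<mm> r E B \<longleftrightarrow> admissible emb \<mm> r E \<and>
     (\<exists>b f. inj_on b {1..r} \<and> b ` {1..r} = B \<and> is_basis r f E \<and>
        (\<forall>j\<in>{1..r}. unit_monic (f j) \<and> degree (f j) = b j))"

definition singular_points :: "nat \<Rightarrow> (nat \<Rightarrow> complex poly) \<Rightarrow> complex set" where
  "singular_points N T = (\<Union>j\<in>{0..N}. {z. poly (T j) z = 0})"

definition K_poly :: "(nat \<Rightarrow> complex poly) \<Rightarrow> nat \<Rightarrow> complex poly" where
  "K_poly T i = (\<Prod>j<i. T j ^ (i - j))"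

definition e_exp :: "(nat \<Rightarrow> complex poly) \<Rightarrow> complex \<Rightarrow> nat \<Rightarrow> nat" where
  "e_exp T z i = i - 1 + (\<Sum>j<i. order z (T j))"

text \<open>Integer valued: that these numbers are non-negative is part of the theorem.\<close>

definition c_exp :: "(nat \<Rightarrow> complex poly) \<Rightarrow> (nat \<Rightarrow> 'a::comm_ring_1 poly) \<Rightarrow> nat \<Rightarrow> int" where
  "c_exp T y i = int i - 1 + int (degree (y i)) - int (degree (y (i - 1))) +
     (\<Sum>j<i. int (degree (T j)))"

end

theory Submission
  imports Defs "Jordan_Normal_Form.Char_Poly"
    "HOL-Computational_Algebra.Fundamental_Theorem_Algebra"
    "HOL-Computational_Algebra.Field_as_Ring"
begin

text \<open>
  Write \<open>Wr(p, q) = p q' - p' q\<close>. Starting from \<open>p\<^sub>k = y\<^sub>k\<close> one solves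
  \<open>Wr(y\<^sub>j, p\<^sub>j) = T\<^sub>j y\<^sub>j\<^sub>-\<^sub>1 p\<^sub>j\<^sub>+\<^sub>1\<close> for \<open>j = k - 1, \<dots>, 1\<close> and puts \<open>u\<^sub>k = T\<^sub>0 p\<^sub>1\<close>. The
  divisibility hypothesis says that \<open>T\<^sub>j y\<^sub>j\<^sub>-\<^sub>1 y\<^sub>j\<^sub>+\<^sub>1 / y\<^sub>j\<^sup>2\<close> has no residues, so that it can be
  integrated, and this property is inherited by \<open>p\<^sub>j\<close> because \<open>y\<^sub>j\<^sub>-\<^sub>1\<close> and \<open>y\<^sub>j\<close> are coprime.
  Coprimality over the residue field lifts to the local ring by Nakayama's lemma.

  Each \<open>p\<^sub>j\<close> is unique up to multiples of \<open>y\<^sub>j\<close>, and such changes alter \<open>u\<^sub>k\<close> only by a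
  combination of \<open>u\<^sub>1, \<dots>, u\<^sub>k\<^sub>-\<^sub>1\<close>. If the multiple is chosen so that the coefficient of \<open>p\<^sub>j\<close> at
  the degree of \<open>y\<^sub>j\<close> vanishes, the leading coefficient of \<open>u\<^sub>k\<close> is a unit and its degree is \<open>c\<^sub>k\<close>;
  if it is chosen so that \<open>p\<^sub>j(z) = 0\<close>, then \<open>u\<^sub>k\<close> is \<open>(x - z)\<close> to the power \<open>e\<^sub>k(z)\<close> times a
  polynomial with invertible value at \<open>z\<close>.
\<close>

text \<open>Over the ring itself this rule is the reversed associativity law, which makes
  \<open>algebra_simps\<close> loop.\<close>

declare ring_mod.scale_scale [simp del]

section \<open>Formal derivatives and binary Wronskians\<close>

lemma coeff_formal_deriv: "coeff (formal_deriv p) n = of_nat (Suc n) * coeff p (Suc n)"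
proof -
  have "coeff (formal_deriv p) n =
      (\<Sum>m=1..degree p. if m = Suc n then of_nat (Suc n) * coeff p (Suc n) else 0)"
    unfolding formal_deriv_def coeff_sum
    by (rule sum.cong) auto
  also have "\<dots> = (if Suc n \<in> {1..degree p} then of_nat (Suc n) * coeff p (Suc n) else 0)"
    by (rule sum.delta) simp
  also have "\<dots> = of_nat (Suc n) * coeff p (Suc n)"
    by (auto simp: coeff_eq_0)
  finally show ?thesis .
qed

lemma formal_deriv_0 [simp]: "formal_deriv 0 = 0"
  by (rule poly_eqI) (simp add: coeff_formal_deriv)

lemma formal_deriv_add: "formal_deriv (p + q) = formal_deriv p + formal_deriv q"
  by (rule poly_eqI)
    (simp add: coeff_formal_deriv distrib_left right_diff_distrib mult.left_commute del: of_nat_Suc)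

lemma formal_deriv_diff: "formal_deriv (p - q) = formal_deriv p - formal_deriv q"
  by (rule poly_eqI)
    (simp add: coeff_formal_deriv distrib_left right_diff_distrib mult.left_commute del: of_nat_Suc)

lemma formal_deriv_smult: "formal_deriv (smult c p) = smult c (formal_deriv p)"
  by (rule poly_eqI)
    (simp add: coeff_formal_deriv distrib_left right_diff_distrib mult.left_commute del: of_nat_Suc)

lemma formal_deriv_sum: "formal_deriv (sum f A) = (\<Sum>x\<in>A. formal_deriv (f x))"
  by (induction A rule: infinite_finite_induct) (auto simp: formal_deriv_add)

lemma formal_deriv_pCons: "formal_deriv (pCons a p) = p + pCons 0 (formal_deriv p)"
  by (rule poly_eqI) (auto simp: coeff_formal_deriv coeff_pCons algebra_simps split: nat.splits)

lemma add_pCons_0: "pCons 0 (p + q) = pCons 0 p + pCons 0 q"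
  by simp

lemma formal_deriv_mult:
  "formal_deriv (p * q) = formal_deriv p * q + p * formal_deriv q"
proof (induction p)
  case (pCons a p)
  have "formal_deriv (pCons a p * q) = smult a (formal_deriv q) + (p * q + pCons 0 (formal_deriv (p * q)))"
    by (simp add: formal_deriv_add formal_deriv_smult formal_deriv_pCons)
  also have "\<dots> = formal_deriv (pCons a p) * q + pCons a p * formal_deriv q"
    by (simp add: pCons.IH formal_deriv_pCons add_pCons_0 algebra_simps del: add_pCons)
  finally show ?case .
qed auto

lemma formal_deriv_linear_power:
  "formal_deriv ([:- c, 1:] ^ Suc n) = smult (of_nat (Suc n)) ([:- c, 1:] ^ n)"
proof (induction n)
  case 0
  show ?case by (simp add: formal_deriv_pCons)
next
  case (Suc n)
  have "formal_deriv [:- c, 1:] = 1" by (simp add: formal_deriv_pCons one_pCons)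
  moreover have "formal_deriv ([:- c, 1:] ^ Suc (Suc n)) =
      formal_deriv [:- c, 1:] * [:- c, 1:] ^ Suc n + [:- c, 1:] * formal_deriv ([:- c, 1:] ^ Suc n)"
    by (subst power_Suc) (rule formal_deriv_mult)
  ultimately have "formal_deriv ([:- c, 1:] ^ Suc (Suc n)) =
      [:- c, 1:] ^ Suc n + smult (of_nat (Suc n)) ([:- c, 1:] ^ Suc n)"
    unfolding Suc by (simp only: mult_1 mult_smult_right power_Suc)
  also have "\<dots> = smult (of_nat (Suc (Suc n))) ([:- c, 1:] ^ Suc n)"
    by (simp only: of_nat_Suc[of "Suc n"] smult_add_left smult_1_left)
  finally show ?case .
qed

definition Wr2 :: "'a::comm_ring_1 poly \<Rightarrow> 'a poly \<Rightarrow> 'a poly" where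
  "Wr2 p q = p * formal_deriv q - formal_deriv p * q"

lemma Wr_pair: "Wr [p, q] = Wr2 p q"
proof -
  let ?A = "mat 2 2 (\<lambda>(i, j). (formal_deriv ^^ i) ([p, q] ! j))"
  have "Wr [p, q] = det ?A"
    by (simp add: Wr_def numeral_2_eq_2)
  also have "\<dots> = (\<Sum>i<2. ?A $$ (i, 0) * cofactor ?A i 0)"
    by (rule laplace_expansion_column) auto
  also have "\<dots> = ?A $$ (0, 0) * cofactor ?A 0 0 + ?A $$ (1, 0) * cofactor ?A 1 0"
    by (simp add: numeral_2_eq_2)
  also have "cofactor ?A 0 0 = ?A $$ (1, 1)"
    by (simp add: cofactor_def mat_delete_def) (subst det_single; simp)
  also have "cofactor ?A 1 0 = - (?A $$ (0, 1))"
    by (simp add: cofactor_def mat_delete_def) (subst det_single; simp)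
  also have "?A $$ (0, 0) * ?A $$ (1, 1) + ?A $$ (1, 0) * - (?A $$ (0, 1)) = Wr2 p q"
    by (simp add: Wr2_def mult.commute)
  finally show ?thesis .
qed

lemma Wr2_self [simp]: "Wr2 p p = 0"
  and Wr2_0_right [simp]: "Wr2 p 0 = 0"
  by (simp_all add: Wr2_def)

lemma Wr2_add_right: "Wr2 p (q + r) = Wr2 p q + Wr2 p r"
  and Wr2_diff_right: "Wr2 p (q - r) = Wr2 p q - Wr2 p r"
  and Wr2_smult_right: "Wr2 p (smult c q) = smult c (Wr2 p q)"
  by (simp_all add: Wr2_def formal_deriv_add formal_deriv_diff formal_deriv_smult
      algebra_simps smult_diff_right)

lemma Wr2_sum_right: "Wr2 p (sum f A) = (\<Sum>x\<in>A. Wr2 p (f x))"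
  by (induction A rule: infinite_finite_induct) (auto simp: Wr2_add_right)

lemma Wr2_mult_both: "Wr2 (r * p) (r * q) = r\<^sup>2 * Wr2 p q"
  by (simp add: Wr2_def formal_deriv_mult algebra_simps power2_eq_square)

section \<open>Coefficients and degrees of products and of binary Wronskians\<close>

lemma coeff_mult_le_degree_sum:
  fixes p q :: "'a::comm_semiring_0 poly"
  assumes "degree p \<le> m" "degree q \<le> n"
  shows "coeff (p * q) (m + n) = coeff p m * coeff q n"
proof -
  have "coeff (p * q) (m + n) = (\<Sum>i\<le>m + n. coeff p i * coeff q (m + n - i))"
    by (simp add: coeff_mult)
  also have "\<dots> = (\<Sum>i\<in>{m}. coeff p i * coeff q (m + n - i))"
  proof (rule sum.mono_neutral_right)
    show "\<forall>i\<in>{..m + n} - {m}. coeff p i * coeff q (m + n - i) = 0"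
    proof
      fix i assume "i \<in> {..m + n} - {m}"
      \<comment> \<open>Away from the index \<open>m\<close>, one of the two factors lies beyond its
        degree bound.\<close>
      then consider "m < i" | "i < m" "n < m + n - i" by fastforce
      then show "coeff p i * coeff q (m + n - i) = 0"
        using assms by cases (auto simp: coeff_eq_0)
    qed
  qed auto
  finally show ?thesis by simp
qed

lemma coeff_pCons_formal_deriv: "coeff (pCons 0 (formal_deriv p)) n = of_nat n * coeff p n"
  by (cases n) (auto simp: coeff_formal_deriv)

lemma degree_pCons_formal_deriv_le: "degree (pCons 0 (formal_deriv p)) \<le> degree p"
  by (rule degree_le) (simp only: coeff_pCons_formal_deriv, simp add: coeff_eq_0)

text \<open>Multiplying by the variable turns differentiation into the Euler operator, which preserves
  degrees; this avoids truncated subtraction in the degree.\<close>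

lemma coeff_pCons_Wr2_degree_sum:
  assumes "degree p \<le> m" "degree q \<le> n"
  shows "coeff (pCons 0 (Wr2 p q)) (m + n) =
    (of_nat n - of_nat m) * (coeff p m * coeff q n)"
proof -
  have "pCons 0 (Wr2 p q) = p * pCons 0 (formal_deriv q) - pCons 0 (formal_deriv p) * q"
    by (simp add: Wr2_def)
  moreover have "degree (pCons 0 (formal_deriv q)) \<le> n" "degree (pCons 0 (formal_deriv p)) \<le> m"
    using degree_pCons_formal_deriv_le assms le_trans by blast+
  ultimately show ?thesis
    by (simp only: coeff_diff coeff_mult_le_degree_sum assms coeff_pCons_formal_deriv)
      (simp add: algebra_simps)
qed

lemma degree_pCons_Wr2_le: "degree (pCons 0 (Wr2 p q)) \<le> degree p + degree q"
proof -
  have "pCons 0 (Wr2 p q) = p * pCons 0 (formal_deriv q) - pCons 0 (formal_deriv p) * q"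
    by (simp add: Wr2_def)
  moreover have "degree (p * pCons 0 (formal_deriv q)) \<le> degree p + degree q"
    by (rule order_trans[OF degree_mult_le]) (simp only: add_left_mono degree_pCons_formal_deriv_le)
  moreover have "degree (pCons 0 (formal_deriv p) * q) \<le> degree p + degree q"
    by (rule order_trans[OF degree_mult_le]) (simp only: add_right_mono degree_pCons_formal_deriv_le)
  ultimately show ?thesis by (metis degree_diff_le)
qed

section \<open>Polynomials with invertible leading coefficient\<close>

lemma unit_cancel_left:
  fixes u :: "'a::comm_ring_1"
  assumes "u dvd 1" "u * a = u * b"
  shows "a = b"
proof -
  obtain v where "1 = u * v" using assms(1) by (elim dvdE)
  with assms(2) show ?thesis
    by (metis mult.assoc mult.commute mult.left_neutral)
qed

lemma unit_mult_eq_0_iff: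
  fixes u :: "'a::comm_ring_1"
  assumes "u dvd 1"
  shows "u * a = 0 \<longleftrightarrow> a = 0"
  using unit_cancel_left[OF assms, of a 0] by auto

lemma unit_monic_nonzero:
  fixes p :: "'a::comm_ring_1 poly"
  assumes "unit_monic p"
  shows "p \<noteq> 0"
  using assms by (auto simp: unit_monic_def)

lemma coeff_unit_monic_mult:
  "coeff (p * q) (degree p + degree q) = lead_coeff p * lead_coeff q"
  for p q :: "'a::comm_ring_1 poly"
  by (rule coeff_mult_le_degree_sum) auto

text \<open>One unit leading coefficient is enough: times the nonzero leading coefficient of the
  other factor it cannot vanish, even in the presence of zero divisors.\<close>

lemma degree_unit_monic_mult:
  fixes p q :: "'a::comm_ring_1 poly"
  assumes "unit_monic p" "q \<noteq> 0"
  shows "degree (p * q) = degree p + degree q"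
proof (rule antisym[OF degree_mult_le])
  have "coeff (p * q) (degree p + degree q) \<noteq> 0"
    using assms by (simp add: coeff_unit_monic_mult unit_monic_def unit_mult_eq_0_iff)
  then show "degree p + degree q \<le> degree (p * q)"
    by (rule le_degree)
qed

lemma unit_monic_mult_eq_0_iff:
  fixes p q :: "'a::comm_ring_1 poly"
  assumes "unit_monic p"
  shows "p * q = 0 \<longleftrightarrow> q = 0"
proof
  assume "p * q = 0"
  then have "lead_coeff p * lead_coeff q = 0"
    by (metis coeff_0 coeff_unit_monic_mult)
  then show "q = 0"
    using assms by (simp add: unit_monic_def unit_mult_eq_0_iff)
qed simp

lemma unit_monic_cancel:
  fixes p q r :: "'a::comm_ring_1 poly"
  assumes "unit_monic p" "p * q = p * r"
  shows "q = r"
  using unit_monic_mult_eq_0_iff[OF assms(1), of "q - r"] assms(2) by (simp add: algebra_simps)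

lemma unit_monic_1 [simp]: "unit_monic (1 :: 'a::comm_ring_1 poly)"
  by (simp add: unit_monic_def)

lemma unit_monic_mult:
  fixes p q :: "'a::comm_ring_1 poly"
  assumes "unit_monic p" "unit_monic q"
  shows "unit_monic (p * q)"
proof -
  have "lead_coeff (p * q) = lead_coeff p * lead_coeff q"
    by (simp add: degree_unit_monic_mult[OF assms(1) unit_monic_nonzero[OF assms(2)]]
        coeff_unit_monic_mult)
  then show ?thesis
    using assms mult_dvd_mono[of "lead_coeff p" 1 "lead_coeff q" 1] by (simp add: unit_monic_def)
qed

lemma unit_monic_prod:
  fixes f :: "'b \<Rightarrow> 'a::comm_ring_1 poly"
  assumes "\<And>x. x \<in> A \<Longrightarrow> unit_monic (f x)"
  shows "unit_monic (prod f A)"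
  using assms by (induction A rule: infinite_finite_induct) (auto intro: unit_monic_mult)

lemma unit_monic_power:
  fixes p :: "'a::comm_ring_1 poly"
  assumes "unit_monic p"
  shows "unit_monic (p ^ n)"
  using assms by (induction n) (auto intro: unit_monic_mult)

text \<open>Euclidean division by \<open>p\<close>. Each quotient term is a multiple of the current
  leading coefficient, which lies in \<open>I\<close>, so no step leaves \<open>I\<close>. With
  \<open>I = \<mm>\<close> this feeds the Nakayama argument below.\<close>

lemma unit_monic_division:
  fixes p q :: "'a::comm_ring_1 poly"
  assumes p: "unit_monic p" and I: "ring_mod.subspace I"
    and q: "\<And>n. coeff q n \<in> I"
  shows "\<exists>d. (\<forall>n. coeff (q - d * p) n \<in> I) \<and> (\<forall>n\<ge>degree p. coeff (q - d * p) n = 0)"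
  using q
proof (induction "degree q" arbitrary: q rule: less_induct)
  case less
  show ?case
  proof (cases "degree q < degree p")
    case True
    then have "\<forall>n\<ge>degree p. coeff (q - 0 * p) n = 0"
      by (simp add: coeff_eq_0)
    with less.prems show ?thesis by (intro exI[of _ 0]) simp
  next
    case False
    obtain v where v: "1 = lead_coeff p * v" using p unfolding unit_monic_def by (elim dvdE)
    let ?t = "monom (v * lead_coeff q) (degree q - degree p)"
    let ?q = "q - ?t * p"
    have coeffs: "coeff ?q n \<in> I" for n
    proof -
      have "lead_coeff q * c \<in> I" for c
        using ring_mod.subspace_scale[OF I less.prems, of c] by (simp add: mult.commute)
      then have "coeff (?t * p) n \<in> I"
        using ring_mod.subspace_0[OF I] by (simp add: coeff_monom_mult mult.assoc mult.left_commute[of v])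
      then show ?thesis
        using less.prems ring_mod.subspace_diff[OF I] by simp
    qed
    have "coeff (?t * p) (degree q) = lead_coeff p * v * lead_coeff q"
      using False unfolding coeff_monom_mult by (simp add: mult_ac)
    then have top: "coeff ?q (degree q) = 0"
      using v by simp
    have "degree (?t * p) \<le> degree q"
      using degree_mult_le[of ?t p] degree_monom_le[of "v * lead_coeff q" "degree q - degree p"] False
      by linarith
    then have deg: "degree ?q \<le> degree q" by (simp add: degree_diff_le)
    \<comment> \<open>If the degree fails to drop, the coefficient at that degree is zero, so the
      remainder is the zero polynomial; this happens only in degree zero.\<close>
    show ?thesis
    proof (cases "degree ?q = degree q")
      case True
      with top have "lead_coeff ?q = 0" by (simp only:)
      then have "?q = 0" by (rule leading_coeff_0_iff[THEN iffD1])
      have "(\<forall>n. coeff ?q n \<in> I) \<and> (\<forall>n\<ge>degree p. coeff ?q n = 0)"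
        unfolding \<open>?q = 0\<close> using ring_mod.subspace_0[OF I] by simp
      then show ?thesis by blast
    next
      case False
      then have "degree ?q < degree q" using deg by linarith
      from less.hyps[OF this] coeffs obtain d where
        "\<forall>n. coeff (?q - d * p) n \<in> I" "\<forall>n\<ge>degree p. coeff (?q - d * p) n = 0" by blast
      moreover have "?q - d * p = q - (?t + d) * p"
        by (simp add: algebra_simps)
      ultimately show ?thesis by metis
    qed
  qed
qed

section \<open>Local algebras over the complex numbers\<close>

text \<open>Zorn's lemma: properness is expressed as \<open>1 \<notin> J\<close>, which passes to
  unions of chains.\<close>

lemma exists_maximal_ideal:
  fixes I :: "'a::comm_ring_1 set"
  assumes I: "ring_mod.subspace I" "1 \<notin> I"
  shows "\<exists>M. maximal_ideal M \<and> I \<subseteq> M"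
proof -
  let ?A = "{J. ring_mod.subspace J \<and> 1 \<notin> J \<and> I \<subseteq> J}"
  have "\<exists>M\<in>?A. \<forall>X\<in>?A. M \<subseteq> X \<longrightarrow> X = M"
  proof (rule subset_Zorn_nonempty)
    show "?A \<noteq> {}" using I by blast
    fix C assume C: "C \<noteq> {}" "subset.chain ?A C"
    have sub: "ring_mod.subspace J" "1 \<notin> J" "I \<subseteq> J" if "J \<in> C" for J
      using C(2) that by (auto simp: subset.chain_def)
    have "ring_mod.subspace (\<Union>C)"
    proof (rule ring_mod.subspaceI)
      show "0 \<in> \<Union>C" using C(1) sub(1) ring_mod.subspace_0 by blast
      show "x + y \<in> \<Union>C" if xy: "x \<in> \<Union>C" "y \<in> \<Union>C" for x y
      proof -
        obtain X Y where XY: "X \<in> C" "x \<in> X" "Y \<in> C" "y \<in> Y" using xy by blast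
        then have "X \<subseteq> Y \<or> Y \<subseteq> X" using C(2) by (auto simp: subset.chain_def)
        with XY show ?thesis using sub(1) ring_mod.subspace_add by blast
      qed
      show "c * x \<in> \<Union>C" if "x \<in> \<Union>C" for c x
        using that sub(1) ring_mod.subspace_scale by blast
    qed
    then show "\<Union>C \<in> ?A" using C(1) sub by blast
  qed
  then obtain M where "M \<in> ?A" and max: "\<forall>X\<in>?A. M \<subseteq> X \<longrightarrow> X = M" by (rule bexE)
  then have M: "ring_mod.subspace M" "1 \<notin> M" "I \<subseteq> M" by simp_all
  have "J = M \<or> J = UNIV" if "ring_mod.subspace J" "M \<subseteq> J" for J
  proof (cases "1 \<in> J")
    case True
    then have "c \<in> J" for c using ring_mod.subspace_scale[OF that(1), of 1 c] by simp
    then show ?thesis by blast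
  next
    case False
    then have "J \<in> ?A" using that M by blast
    then show ?thesis using max that by blast
  qed
  with M have "maximal_ideal M" by (auto simp: maximal_ideal_def)
  with M show ?thesis by blast
qed

context local_complex_algebra
begin

lemma ideal: "ring_mod.subspace \<mm>"
  using maximal by (simp add: maximal_ideal_def)

lemma ideal_mult_left: "a \<in> \<mm> \<Longrightarrow> c * a \<in> \<mm>"
  using ring_mod.subspace_scale[OF ideal] .

lemma ideal_mult_right: "a \<in> \<mm> \<Longrightarrow> a * c \<in> \<mm>"
  using ideal_mult_left by (simp add: mult.commute)

lemma one_notin_ideal: "1 \<notin> \<mm>"
proof
  assume "1 \<in> \<mm>"
  then have "c \<in> \<mm>" for c using ideal_mult_left[of 1 c] by simp
  then show False using maximal by (auto simp: maximal_ideal_def)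
qed

text \<open>A nonunit generates a proper ideal, which lies in a maximal ideal and hence in
  \<open>\<mm>\<close>; a unit in \<open>\<mm>\<close> would put 1 there.\<close>

lemma unit_iff: "a dvd 1 \<longleftrightarrow> a \<notin> \<mm>"
proof
  assume "a dvd 1"
  then show "a \<notin> \<mm>" using ideal_mult_right one_notin_ideal by (metis dvdE)
next
  assume "a \<notin> \<mm>"
  let ?I = "range (\<lambda>c. c * a)"
  have I: "ring_mod.subspace ?I"
    using ring_mod.span_singleton[of a] ring_mod.subspace_span[of "{a}"] by simp
  show "a dvd 1"
  proof (rule ccontr)
    assume "\<not> a dvd 1"
    then have "1 \<notin> ?I" by (metis dvd_triv_right imageE)
    with exists_maximal_ideal[OF I] unique_maximal have "?I \<subseteq> \<mm>" by blast
    then have "1 * a \<in> \<mm>" by blast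
    with \<open>a \<notin> \<mm>\<close> show False by simp
  qed
qed

lemma residue_eqI: "a - emb c \<in> \<mm> \<Longrightarrow> residue emb \<mm> a = c"
  unfolding residue_def using residue_field[of a] by (intro the_equality) auto

lemma minus_residue: "a - emb (residue emb \<mm> a) \<in> \<mm>"
  unfolding residue_def using residue_field[of a] by (rule theI')

lemma residue_emb [simp]: "residue emb \<mm> (emb c) = c"
  by (rule residue_eqI) (simp add: ring_mod.subspace_0[OF ideal])

sublocale residue: comm_ring_hom "residue emb \<mm>"
proof
  show "residue emb \<mm> 0 = 0" "residue emb \<mm> 1 = 1"
    using residue_emb[of 0] residue_emb[of 1] by simp_all
  fix a b
  have sum: "(a + b) - emb (residue emb \<mm> a + residue emb \<mm> b) =
      (a - emb (residue emb \<mm> a)) + (b - emb (residue emb \<mm> b))"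
    by (simp add: hom_add)
  show "residue emb \<mm> (a + b) = residue emb \<mm> a + residue emb \<mm> b"
    by (rule residue_eqI) (unfold sum, intro ring_mod.subspace_add[OF ideal] minus_residue)
  have prod: "a * b - emb (residue emb \<mm> a * residue emb \<mm> b) =
      b * (a - emb (residue emb \<mm> a)) + emb (residue emb \<mm> a) * (b - emb (residue emb \<mm> b))"
    by (simp add: hom_mult algebra_simps)
  show "residue emb \<mm> (a * b) = residue emb \<mm> a * residue emb \<mm> b"
    by (rule residue_eqI)
      (unfold prod, intro ring_mod.subspace_add[OF ideal] ideal_mult_left minus_residue)
qed

lemma residue_eq_0_iff: "residue emb \<mm> a = 0 \<longleftrightarrow> a \<in> \<mm>"
  using residue_eqI[of a 0] minus_residue[of a] by (auto simp: hom_zero)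

lemma unit_iff_residue: "a dvd 1 \<longleftrightarrow> residue emb \<mm> a \<noteq> 0"
  by (simp add: unit_iff residue_eq_0_iff)

lemma coeff_reduce [simp]: "coeff (reduce emb \<mm> p) n = residue emb \<mm> (coeff p n)"
  by (simp add: reduce_def)

sublocale reduce: comm_ring_hom "reduce emb \<mm>"
proof -
  interpret h: map_poly_comm_ring_hom "residue emb \<mm>" ..
  show "comm_ring_hom (reduce emb \<mm>)"
    unfolding reduce_def by (rule h.comm_ring_hom_axioms)
qed

sublocale emb_poly: comm_ring_hom "map_poly emb"
proof -
  interpret h: map_poly_comm_ring_hom emb ..
  show "comm_ring_hom (map_poly emb)" by (rule h.comm_ring_hom_axioms)
qed

lemma reduce_emb [simp]: "reduce emb \<mm> (map_poly emb p) = p"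
  by (rule poly_eqI) simp

lemma reduce_eq_0_iff: "reduce emb \<mm> p = 0 \<longleftrightarrow> (\<forall>n. coeff p n \<in> \<mm>)"
  by (auto simp: poly_eq_iff residue_eq_0_iff)

lemma poly_reduce: "poly (reduce emb \<mm> p) z = residue emb \<mm> (poly p (emb z))"
  using residue.poly_map_poly[of p "emb z"] by (simp add: reduce_def)

lemma reduce_formal_deriv: "reduce emb \<mm> (formal_deriv p) = pderiv (reduce emb \<mm> p)"
  by (rule poly_eqI) (simp add: coeff_formal_deriv coeff_pderiv residue.hom_mult residue.hom_of_nat
      del: of_nat_Suc)

lemma of_nat_unit: "n > 0 \<Longrightarrow> (of_nat n :: 'a) dvd 1"
  by (simp add: unit_iff_residue residue.hom_of_nat)

lemma of_nat_diff_unit: "m \<noteq> n \<Longrightarrow> (of_nat m - of_nat n :: 'a) dvd 1"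
  by (simp add: unit_iff_residue residue.hom_of_nat residue.hom_minus)

lemma unit_monic_emb: "p \<noteq> 0 \<Longrightarrow> unit_monic (map_poly emb p)"
  and degree_emb: "degree (map_poly emb p) = degree p"
proof -
  have deg: "degree (map_poly emb p) = degree p" for p
  proof (rule antisym[OF degree_map_poly_le])
    \<comment> \<open>Reduction undoes \<open>emb\<close>, and neither map raises degrees.\<close>
    show "degree p \<le> degree (map_poly emb p)"
      using degree_map_poly_le[of "residue emb \<mm>" "map_poly emb p"]
      by (simp flip: reduce_def)
  qed
  then show "degree (map_poly emb p) = degree p" .
  show "unit_monic (map_poly emb p)" if "p \<noteq> 0"
    using that by (simp add: unit_monic_def unit_iff_residue deg)
qed

text \<open>A Bezout identity over the residue field only gives an element of the ideal
  \<open>(p, q)\<close> that is congruent to 1. Since \<open>p\<close> has a unit leading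
  coefficient, the quotient by \<open>p\<close> is a finite module over the local ring, and
  Nakayama's lemma applies.\<close>

lemma coprime_lift:
  fixes p q :: "'a poly"
  assumes p: "unit_monic p" and coprime: "coprime (reduce emb \<mm> p) (reduce emb \<mm> q)"
  shows "\<exists>a b. a * p + b * q = 1"
proof -
  define J where "J = {r. \<exists>a b. r = a * p + b * q}"
  have Jmult: "c * r \<in> J" if rJ: "r \<in> J" for c r
  proof -
    obtain a b where "r = a * p + b * q" using rJ unfolding J_def by blast
    then have "c * r = (c * a) * p + (c * b) * q" by (simp add: algebra_simps)
    then show ?thesis unfolding J_def by blast
  qed
  have Jdiff: "r - s \<in> J" if rs: "r \<in> J" "s \<in> J" for r s
  proof -
    obtain a b c d where "r = a * p + b * q" "s = c * p + d * q" using rs unfolding J_def by blast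
    then have "r - s = (a - c) * p + (b - d) * q" by (simp add: algebra_simps)
    then show ?thesis unfolding J_def by blast
  qed
  have "1 * p + 0 * q \<in> J" unfolding J_def by blast
  then have pJ: "p \<in> J" by simp
  obtain a b where ab: "a * reduce emb \<mm> p + b * reduce emb \<mm> q = 1"
    using bezout_coefficients_fst_snd[of "reduce emb \<mm> p" "reduce emb \<mm> q"] coprime
    by (metis coprime_iff_gcd_eq_1)
  define r0 where "r0 = map_poly emb a * p + map_poly emb b * q"
  have r0: "r0 \<in> J" "reduce emb \<mm> r0 = 1"
    using ab by (auto simp: r0_def J_def reduce.hom_add reduce.hom_mult)
  \<comment> \<open>Nakayama's lemma by elimination: modulo \<open>p\<close> the ideal \<open>J\<close> contains a small perturbation of
    each power of the variable, and these have an invertible matrix of coefficients.\<close>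
  define P where "P j \<longleftrightarrow> (\<forall>k<j. \<exists>r\<in>J. (\<forall>i\<ge>j. coeff r i = 0) \<and> reduce emb \<mm> r = monom 1 k)"
    for j
  have top: "P (degree p)"
    unfolding P_def
  proof (intro allI impI)
    fix k assume k: "k < degree p"
    \<comment> \<open>Since \<open>r0\<close> reduces to 1, \<open>s\<close> has all coefficients in
      \<open>\<mm>\<close>. Division by \<open>p\<close> lowers its degree while keeping the
      coefficients in \<open>\<mm>\<close> and changing it only by a multiple of
      \<open>p\<close>.\<close>
    define s where "s = monom 1 k * r0 - monom 1 k"
    have red_monom: "reduce emb \<mm> (monom 1 k) = monom 1 k"
      by (rule poly_eqI) simp
    have "reduce emb \<mm> s = 0"
      using r0 red_monom by (simp add: s_def reduce.hom_minus reduce.hom_mult)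
    then obtain d where d: "\<forall>n. coeff (s - d * p) n \<in> \<mm>" "\<forall>n\<ge>degree p. coeff (s - d * p) n = 0"
      using unit_monic_division[OF p ideal] unfolding reduce_eq_0_iff by blast
    let ?r = "monom 1 k + (s - d * p)"
    have "?r = monom 1 k * r0 - d * p" by (simp add: s_def)
    then have "?r \<in> J" using Jdiff[OF Jmult[OF r0(1)] Jmult[OF pJ]] by (simp only:)
    moreover have "\<forall>i\<ge>degree p. coeff ?r i = 0" using d k by (simp only: coeff_add) simp
    moreover have "reduce emb \<mm> (s - d * p) = 0" using d by (simp only: reduce_eq_0_iff) simp
    then have "reduce emb \<mm> ?r = monom 1 k" by (simp only: reduce.hom_add red_monom add_0_right)
    ultimately show "\<exists>r\<in>J. (\<forall>i\<ge>degree p. coeff r i = 0) \<and> reduce emb \<mm> r = monom 1 k" by blast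
  qed
  have step: "P j" if "P (Suc j)" for j
    unfolding P_def
  proof (intro allI impI)
    fix k assume k: "k < j"
    obtain r where r: "r \<in> J" "\<forall>i\<ge>Suc j. coeff r i = 0" "reduce emb \<mm> r = monom 1 k"
      using \<open>P (Suc j)\<close> k unfolding P_def by (metis less_SucI)
    obtain s where s: "s \<in> J" "\<forall>i\<ge>Suc j. coeff s i = 0" "reduce emb \<mm> s = monom 1 j"
      using \<open>P (Suc j)\<close> unfolding P_def by blast
    have "residue emb \<mm> (coeff s j) = 1"
      using s(3) by (metis coeff_monom coeff_reduce)
    then have "coeff s j dvd 1" by (simp add: unit_iff_residue)
    then obtain v where v: "1 = coeff s j * v" by (elim dvdE)
    have rj: "residue emb \<mm> (coeff r j) = 0"
      using r(3) k by (metis coeff_monom coeff_reduce less_irrefl)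
    \<comment> \<open>The pivot \<open>coeff s j\<close> has inverse \<open>v\<close>. The
      multiplier lies in \<open>\<mm>\<close> because \<open>k \<noteq> j\<close>, so clearing the
      coefficient at \<open>j\<close> leaves the reduction unchanged.\<close>
    let ?r = "r - [:coeff r j * v:] * s"
    have "?r \<in> J" by (intro Jdiff Jmult r s)
    moreover have "coeff ?r i = 0" if "i \<ge> j" for i
    proof (cases "i = j")
      case True
      have "coeff r j * v * coeff s j = coeff r j * (coeff s j * v)" by (simp only: mult_ac)
      then have "coeff r j * v * coeff s j = coeff r j" by (simp flip: v)
      then show ?thesis using True by simp
    next
      case False
      then show ?thesis using that r(2) s(2) by simp
    qed
    moreover have "reduce emb \<mm> ?r = monom 1 k"
      using r(3) rj
      by (intro poly_eqI) (simp add: residue.hom_minus residue.hom_mult flip: r(3))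
    ultimately show "\<exists>r\<in>J. (\<forall>i\<ge>j. coeff r i = 0) \<and> reduce emb \<mm> r = monom 1 k" by blast
  qed
  \<comment> \<open>A constant \<open>p\<close> is itself such a unit; otherwise elimination down to
    \<open>P 1\<close> leaves a constant of residue 1 in \<open>J\<close>.\<close>
  have "\<exists>u\<in>J. degree u = 0 \<and> coeff u 0 dvd 1"
  proof (cases "degree p = 0")
    case True
    then show ?thesis using p pJ by (auto simp: unit_monic_def)
  next
    case False
    then have "1 \<le> degree p" by simp
    then have "P 1"
      using top by (rule inc_induct) (rule step)
    then obtain u where u: "u \<in> J" "\<forall>i\<ge>1. coeff u i = 0" "reduce emb \<mm> u = monom 1 0"
      unfolding P_def by blast
    have "residue emb \<mm> (coeff u 0) = 1"
      using u(3) by (metis coeff_monom coeff_reduce)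
    moreover have "degree u \<le> 0" using u(2) by (intro degree_le) auto
    ultimately show ?thesis using u(1) by (auto simp: unit_iff_residue)
  qed
  then obtain u where u: "u \<in> J" "degree u = 0" "coeff u 0 dvd 1" by blast
  then obtain v where v: "1 = coeff u 0 * v" by (elim dvdE)
  from u(2) obtain c where "u = [:c:]" by (elim degree_eq_zeroE)
  with v have "[:v:] * u = 1" by (simp add: mult.commute one_pCons)
  with Jmult[OF u(1), of "[:v:]"] have "1 \<in> J" by simp
  then show ?thesis unfolding J_def by auto
qed

section \<open>The equation \<open>Wr2 y p = r\<close>: integration, degrees, vanishing orders,
  solvability\<close>

lemma antiderivative: "\<exists>q. formal_deriv q = p" for p :: "'a poly"
proof -
  \<comment> \<open>The division by \<open>n + 1\<close> takes place in the complex numbers, before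
    \<open>emb\<close> is applied.\<close>
  define q where "q = (\<Sum>n\<le>degree p. monom (emb (1 / of_nat (Suc n)) * coeff p n) (Suc n))"
  have "coeff q (Suc n) = emb (1 / of_nat (Suc n)) * coeff p n" for n
  proof -
    have "coeff q (Suc n) =
        (\<Sum>m\<le>degree p. if m = n then emb (1 / of_nat (Suc n)) * coeff p n else 0)"
      unfolding q_def coeff_sum by (rule sum.cong) auto
    then show ?thesis by (simp add: coeff_eq_0)
  qed
  moreover have "of_nat (Suc n) * emb (1 / of_nat (Suc n)) = 1" for n
  proof -
    have "of_nat (Suc n) * emb (1 / of_nat (Suc n)) = emb (of_nat (Suc n) * (1 / of_nat (Suc n)))"
      by (simp only: hom_mult hom_of_nat)
    also have "\<dots> = 1" by (simp del: of_nat_Suc)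
    finally show ?thesis .
  qed
  ultimately have "formal_deriv q = p"
    by (intro poly_eqI) (simp add: coeff_formal_deriv mult.assoc[symmetric] del: of_nat_Suc)
  then show ?thesis ..
qed

text \<open>The leading terms combine with the factor \<open>degree p - degree y\<close>, a nonzero
  integer and hence a unit, so they do not cancel. The last conclusion transfers invertibility from
  the Wronskian back to \<open>p\<close>.\<close>

lemma coeff_Wr2_top:
  fixes y p :: "'a poly"
  assumes "unit_monic y" "p \<noteq> 0" "degree p \<noteq> degree y"
  shows "Wr2 y p \<noteq> 0" "Suc (degree (Wr2 y p)) = degree y + degree p"
    "lead_coeff p dvd lead_coeff (Wr2 y p)"
proof -
  let ?W = "pCons 0 (Wr2 y p)" and ?c = "(of_nat (degree p) - of_nat (degree y)) * lead_coeff y :: 'a"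
  have top: "coeff ?W (degree y + degree p) = ?c * lead_coeff p"
    by (subst coeff_pCons_Wr2_degree_sum) (simp_all add: mult.assoc)
  have "?c dvd 1"
    using assms mult_dvd_mono[of _ 1 _ 1] of_nat_diff_unit by (auto simp: unit_monic_def)
  then have nz: "coeff ?W (degree y + degree p) \<noteq> 0"
    unfolding top using assms(2) by (simp add: unit_mult_eq_0_iff)
  then show W: "Wr2 y p \<noteq> 0" by auto
  have "degree ?W = degree y + degree p"
    using degree_pCons_Wr2_le le_degree[OF nz] by (rule antisym)
  then show deg: "Suc (degree (Wr2 y p)) = degree y + degree p"
    using W by simp
  have "lead_coeff (Wr2 y p) = ?c * lead_coeff p"
    using top by (simp flip: deg)
  then show "lead_coeff p dvd lead_coeff (Wr2 y p)" by simp
qed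

text \<open>Subtracting a multiple of \<open>y\<close> clears the coefficient at
  \<open>degree y\<close>. A nonzero remainder would then have a degree other than that of
  \<open>y\<close>, hence a nonzero Wronskian.\<close>

lemma Wr2_eq_0:
  fixes y p :: "'a poly"
  assumes y: "unit_monic y" and "Wr2 y p = 0"
  shows "\<exists>c. p = smult c y"
proof -
  obtain v where v: "1 = lead_coeff y * v" using y unfolding unit_monic_def by (elim dvdE)
  define q where "q = p - smult (v * coeff p (degree y)) y"
  have "Wr2 y q = 0" using assms(2) by (simp add: q_def Wr2_diff_right Wr2_smult_right)
  moreover have "coeff q (degree y) = 0"
    using v by (simp add: q_def) (metis mult.assoc mult.commute mult_1)
  ultimately have "q = 0"
    using coeff_Wr2_top(1)[OF y, of q] by (metis leading_coeff_0_iff)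
  then show ?thesis by (auto simp: q_def)
qed

text \<open>The vanishing coefficient rules out \<open>degree p = degree y\<close>, the one case in
  which the leading terms of the Wronskian cancel.\<close>

lemma Wr2_unit_monic:
  fixes y p :: "'a poly"
  assumes y: "unit_monic y" and W: "unit_monic (Wr2 y p)" and "coeff p (degree y) = 0"
  shows "unit_monic p" "degree y + degree p = Suc (degree (Wr2 y p))" "degree p \<noteq> degree y"
proof -
  have p: "p \<noteq> 0" using unit_monic_nonzero[OF W] by auto
  with assms(3) show deg: "degree p \<noteq> degree y" by (metis leading_coeff_0_iff)
  show "unit_monic p"
    using coeff_Wr2_top(3)[OF y p deg] W dvd_trans unfolding unit_monic_def by blast
  show "degree y + degree p = Suc (degree (Wr2 y p))"
    using coeff_Wr2_top(2)[OF y p deg] by simp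
qed

text \<open>Where \<open>y\<close> is invertible, the equation integrates \<open>(p / y)'\<close>,
  so a solution vanishing at \<open>c\<close> has order exactly one more than the right-hand side.
  The factors are split off one at a time.\<close>

lemma Wr2_root_order:
  fixes y p :: "'a poly"
  assumes y: "poly y c dvd 1" and W: "Wr2 y p = [:- c, 1:] ^ n * h" and h: "poly h c dvd 1"
    and p: "poly p c = 0"
  shows "\<exists>q. p = [:- c, 1:] ^ Suc n * q \<and> poly q c dvd 1"
proof -
  let ?t = "[:- c, 1:]"
  have t: "unit_monic (?t ^ k)" for k
    by (rule unit_monic_power) (simp add: unit_monic_def)
  have factor: "\<exists>q. q' = ?t * q" if "poly q' c = 0" for q'
    using that by (metis poly_eq_0_iff_dvd dvdE)
  have split: "Wr2 y (?t ^ Suc k * q) = ?t ^ k * (smult (of_nat (Suc k)) (y * q) + ?t * Wr2 y q)" for k q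
    unfolding Wr2_def formal_deriv_mult[of "?t ^ Suc k"] formal_deriv_linear_power
    by (simp add: algebra_simps del: mult_pCons_left mult_pCons_right of_nat_Suc)
  have "\<exists>q. p = ?t ^ Suc k * q" if "k \<le> n" for k
    using that
  proof (induction k)
    case 0
    then show ?case using factor[OF p] by simp
  next
    case (Suc k)
    then obtain q where q: "p = ?t ^ Suc k * q" by auto
    have n: "n = k + Suc (n - Suc k)" using Suc.prems by simp
    have "?t ^ k * (smult (of_nat (Suc k)) (y * q) + ?t * Wr2 y q) = ?t ^ k * (?t ^ Suc (n - Suc k) * h)"
      using W unfolding q split by (subst (asm) n) (simp only: power_add mult.assoc)
    then have "smult (of_nat (Suc k)) (y * q) + ?t * Wr2 y q = ?t ^ Suc (n - Suc k) * h"
      by (rule unit_monic_cancel[OF t])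
    \<comment> \<open>As \<open>k < n\<close>, a factor \<open>?t\<close> remains in both the
      Wronskian term and the right-hand side; at \<open>c\<close> only the first summand
      survives.\<close>
    from arg_cong[OF this, of "\<lambda>r. poly r c"] have "of_nat (Suc k) * (poly y c * poly q c) = 0"
      by simp
    then have "poly q c = 0"
      using unit_mult_eq_0_iff[OF y] unit_mult_eq_0_iff[OF of_nat_unit[of "Suc k"]] by blast
    then obtain q' where "q = ?t * q'" using factor by blast
    then have "p = ?t ^ Suc (Suc k) * q'" using q by (simp only: power_Suc mult_ac)
    then show ?case ..
  qed
  then obtain q where q: "p = ?t ^ Suc n * q" by blast
  \<comment> \<open>At \<open>k = n\<close> the power is used up, so the values at \<open>c\<close>
    show that \<open>poly q c\<close> divides the unit \<open>poly h c\<close>.\<close>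
  have "?t ^ n * (smult (of_nat (Suc n)) (y * q) + ?t * Wr2 y q) = ?t ^ n * h"
    using W unfolding q split .
  then have "smult (of_nat (Suc n)) (y * q) + ?t * Wr2 y q = h"
    by (rule unit_monic_cancel[OF t])
  from arg_cong[OF this, of "\<lambda>r. poly r c"] have "poly h c = poly q c * (of_nat (Suc n) * poly y c)"
    by (simp add: mult_ac del: of_nat_Suc)
  then have "poly q c dvd poly h c" by simp
  with h q show ?thesis using dvd_trans by blast
qed

text \<open>Formally \<open>(p / y)' = r / y^2\<close>. Writing \<open>r = y h - y' g\<close> by
  Bezout gives \<open>r / y^2 = (g / y)' + (h - g') / y\<close>. The divisibility hypothesis makes
  the last quotient a polynomial \<open>w\<close>, and \<open>p = g + y v\<close> with
  \<open>v' = w\<close> is a solution.\<close>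

lemma Wr2_solvable:
  fixes y r :: "'a poly"
  assumes y: "unit_monic y" and cop: "a * y + b * formal_deriv y = 1"
    and dvd: "y dvd Wr2 (formal_deriv y) r"
  shows "\<exists>p. Wr2 y p = r"
proof -
  define g h where "g = - b * r" and "h = a * r"
  have r: "r = y * h - formal_deriv y * g"
    using arg_cong[OF cop, of "\<lambda>s. s * r"] by (simp add: g_def h_def algebra_simps)
  let ?y' = "formal_deriv y"
  have "Wr2 ?y' r = ?y' * ?y' * (h - formal_deriv g) + y * (?y' * formal_deriv h - formal_deriv ?y' * h)"
    by (simp add: Wr2_def r formal_deriv_diff formal_deriv_mult algebra_simps)
  with dvd have d: "y dvd ?y' * ?y' * (h - formal_deriv g)"
    by (metis dvd_add_left_iff dvd_triv_left)
  \<comment> \<open>The square of the Bezout identity removes the factor \<open>?y' * ?y'\<close>,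
    which is invertible modulo \<open>y\<close>.\<close>
  have "h - formal_deriv g = (a * y + b * ?y') * (a * y + b * ?y') * (h - formal_deriv g)"
    by (simp add: cop)
  also have "\<dots> = y * ((a * (a * y + b * ?y') + b * ?y' * a) * (h - formal_deriv g)) +
      b * b * (?y' * ?y' * (h - formal_deriv g))"
    by (simp add: algebra_simps)
  also have "y dvd \<dots>" by (rule dvd_add[OF dvd_triv_left dvd_mult[OF d]])
  finally obtain w where w: "h - formal_deriv g = y * w" by (elim dvdE)
  obtain v where v: "formal_deriv v = w" using antiderivative by blast
  have "Wr2 y (g + y * v) = y * (formal_deriv g + y * w) - ?y' * g"
    by (simp add: Wr2_def formal_deriv_add formal_deriv_mult v algebra_simps)
  also have "\<dots> = r" using w by (simp add: r algebra_simps flip: w)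
  finally show ?thesis ..
qed

text \<open>A common divisor of the reduction and its derivative has no complex root, so it is
  constant; the resulting coprimality is then lifted.\<close>

lemma rsquarefree_lift:
  assumes "unit_monic y" "rsquarefree (reduce emb \<mm> y)"
  shows "\<exists>a b. a * y + b * formal_deriv y = 1"
proof (rule coprime_lift[OF assms(1)])
  let ?p = "reduce emb \<mm> y"
  have no_root: "\<not> (poly ?p z = 0 \<and> poly (pderiv ?p) z = 0)" for z
    using assms(2) by (simp add: rsquarefree_roots)
  have "?p \<noteq> 0" using assms(2) by (simp add: rsquarefree_def)
  show "coprime ?p (reduce emb \<mm> (formal_deriv y))"
    unfolding reduce_formal_deriv
  proof (rule coprimeI)
    fix d assume d: "d dvd ?p" "d dvd pderiv ?p"
    have "poly d z \<noteq> 0" for z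
      using no_root[of z] d by (metis dvd_def mult_eq_0_iff poly_mult)
    then have "constant (poly d)" using fundamental_theorem_of_algebra by blast
    then have "degree d = 0" by (simp add: constant_degree)
    moreover have "d \<noteq> 0" using d(1) \<open>?p \<noteq> 0\<close> by auto
    ultimately show "is_unit d" by (simp add: is_unit_iff_degree)
  qed
qed

end

section \<open>Bases of spans of polynomials\<close>

lemma span_image_finite:
  assumes "finite A"
  shows "poly_mod.span (f ` A) = range (\<lambda>a. \<Sum>k\<in>A. smult (a k) (f k))"
proof (rule poly_mod.span_subspace)
  show "f ` A \<subseteq> range (\<lambda>a. \<Sum>k\<in>A. smult (a k) (f k))"
  proof
    fix p assume "p \<in> f ` A"
    then obtain k where k: "k \<in> A" "p = f k" by blast
    have "(\<Sum>j\<in>A. smult (if j = k then 1 else 0) (f j)) = (\<Sum>j\<in>A. if j = k then f k else 0)"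
      by (rule sum.cong) auto
    also have "\<dots> = p" using k assms by simp
    finally show "p \<in> range (\<lambda>a. \<Sum>k\<in>A. smult (a k) (f k))"
      by (intro range_eqI) (rule sym)
  qed
  show "range (\<lambda>a. \<Sum>k\<in>A. smult (a k) (f k)) \<subseteq> poly_mod.span (f ` A)"
    by (intro image_subsetI poly_mod.span_sum poly_mod.span_scale poly_mod.span_base imageI)
  show "poly_mod.subspace (range (\<lambda>a. \<Sum>k\<in>A. smult (a k) (f k)))"
  proof (rule poly_mod.subspaceI)
    show "0 \<in> range (\<lambda>a. \<Sum>k\<in>A. smult (a k) (f k))"
      by (rule range_eqI[of _ _ "\<lambda>_. 0"]) simp
  next
    fix p q
    assume "p \<in> range (\<lambda>a. \<Sum>k\<in>A. smult (a k) (f k))" "q \<in> range (\<lambda>a. \<Sum>k\<in>A. smult (a k) (f k))"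
    then obtain a b where "p = (\<Sum>k\<in>A. smult (a k) (f k))" "q = (\<Sum>k\<in>A. smult (b k) (f k))" by auto
    then have "p + q = (\<Sum>k\<in>A. smult (a k + b k) (f k))"
      by (simp add: smult_add_left sum.distrib)
    then show "p + q \<in> range (\<lambda>a. \<Sum>k\<in>A. smult (a k) (f k))"
      by (rule range_eqI[where x = "\<lambda>k. a k + b k"])
  next
    fix c p
    assume "p \<in> range (\<lambda>a. \<Sum>k\<in>A. smult (a k) (f k))"
    then obtain a where "p = (\<Sum>k\<in>A. smult (a k) (f k))" by auto
    then have "smult c p = (\<Sum>k\<in>A. smult (c * a k) (f k))"
      by (simp add: poly_mod.scale_sum_right)
    then show "smult c p \<in> range (\<lambda>a. \<Sum>k\<in>A. smult (a k) (f k))"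
      by (rule range_eqI[where x = "\<lambda>k. c * a k"])
  qed
qed

text \<open>\<open>is_basis\<close> refers to the set of values, so repetitions must be excluded
  too: equal values at \<open>i\<close> and \<open>j\<close> would give a relation with coefficients
  1 and -1.\<close>

lemma is_basisI:
  assumes indep: "\<And>a k. (\<Sum>k=1..r. smult (a k) (f k)) = 0 \<Longrightarrow> k \<in> {1..r} \<Longrightarrow> a k = 0"
    and span: "poly_mod.span (f ` {1..r}) = E"
  shows "is_basis r f E"
proof -
  have inj: "inj_on f {1..r}"
  proof (rule inj_onI, rule ccontr)
    fix i j assume ij: "i \<in> {1..r}" "j \<in> {1..r}" "f i = f j" "i \<noteq> j"
    let ?a = "\<lambda>k. (if k = i then 1 else 0) - (if k = j then 1 else 0)"
    have "(\<Sum>k=1..r. smult (?a k) (f k)) =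
        (\<Sum>k=1..r. (if k = i then f i else 0) - (if k = j then f j else 0))"
      by (rule sum.cong) (auto simp: smult_diff_left)
    also have "\<dots> = f i - f j" using ij by (simp add: sum_subtractf)
    finally have "(\<Sum>k=1..r. smult (?a k) (f k)) = 0" using ij by simp
    from indep[OF this ij(1)] ij(4) show False by simp
  qed
  have "\<not> poly_mod.dependent (f ` {1..r})"
  proof
    assume "poly_mod.dependent (f ` {1..r})"
    then obtain a where a: "\<exists>p\<in>f ` {1..r}. a p \<noteq> 0" "(\<Sum>p\<in>f ` {1..r}. smult (a p) p) = 0"
      by (auto simp: poly_mod.dependent_finite)
    have "(\<Sum>k=1..r. smult (a (f k)) (f k)) = 0"
      using a(2) unfolding sum.reindex[OF inj] by (simp only: o_def)
    with indep[of "\<lambda>k. a (f k)"] a(1) show False by blast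
  qed
  with inj span show ?thesis by (simp add: is_basis_def)
qed

text \<open>Among the indices with \<open>a j \<notin> I\<close> take the one of largest degree. At
  that degree all other terms contribute elements of \<open>I\<close>, so \<open>a m\<close> times a
  unit lies in \<open>I\<close>. The zero ideal yields independence, \<open>\<mm>\<close> yields
  admissibility.\<close>

lemma unit_monic_sum_coeffs:
  fixes f :: "nat \<Rightarrow> 'a::comm_ring_1 poly"
  assumes A: "finite A" "\<And>k. k \<in> A \<Longrightarrow> unit_monic (f k)" "inj_on (\<lambda>k. degree (f k)) A"
    and I: "ring_mod.subspace I" "\<And>n. coeff (\<Sum>k\<in>A. smult (a k) (f k)) n \<in> I"
    and k: "k \<in> A"
  shows "a k \<in> I"
proof (rule ccontr)
  assume "a k \<notin> I"
  let ?B = "{j \<in> A. a j \<notin> I}"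
  have B: "finite ?B" "?B \<noteq> {}" using A(1) k \<open>a k \<notin> I\<close> by auto
  have "Max ((\<lambda>j. degree (f j)) ` ?B) \<in> (\<lambda>j. degree (f j)) ` ?B"
    using B by (intro Max_in) auto
  then obtain m where m: "m \<in> ?B" "Max ((\<lambda>j. degree (f j)) ` ?B) = degree (f m)" by auto
  have max: "degree (f j) \<le> degree (f m)" if "j \<in> ?B" for j
    unfolding m(2)[symmetric] using B(1) that by (intro Max_ge) auto
  let ?c = "\<lambda>j. a j * coeff (f j) (degree (f m))"
  have "?c j \<in> I" if "j \<in> A - {m}" for j
  proof (cases "a j \<in> I")
    case True
    then show ?thesis using ring_mod.subspace_scale[OF I(1)] by (simp add: mult.commute)
  next
    case False
    then have "degree (f j) \<le> degree (f m)" using max that by blast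
    moreover have "degree (f j) \<noteq> degree (f m)"
      using inj_onD[OF A(3), of j m] that m by auto
    ultimately show ?thesis using ring_mod.subspace_0[OF I(1)] by (simp add: coeff_eq_0)
  qed
  then have rest: "sum ?c (A - {m}) \<in> I" by (rule ring_mod.subspace_sum[OF I(1)])
  have all: "sum ?c A \<in> I" using I(2)[of "degree (f m)"] by (simp add: coeff_sum)
  have "sum ?c A = ?c m + sum ?c (A - {m})"
    using A(1) m(1) by (intro sum.remove) auto
  then have "sum ?c A - sum ?c (A - {m}) = ?c m" by simp
  with ring_mod.subspace_diff[OF I(1) all rest] have "?c m \<in> I" by (simp only:)
  moreover obtain v where v: "1 = lead_coeff (f m) * v"
    using A(2)[of m] m(1) unfolding unit_monic_def by (auto elim: dvdE)
  have "v * ?c m = a m * (lead_coeff (f m) * v)" by (simp only: mult_ac)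
  then have "v * ?c m = a m" by (simp flip: v)
  ultimately have "a m \<in> I" using ring_mod.subspace_scale[OF I(1), of "?c m" v] by (simp only:)
  with m(1) show False by blast
qed

lemma unit_monic_is_basis:
  assumes "\<And>k. k \<in> {1..n} \<Longrightarrow> unit_monic (f k)" "inj_on (\<lambda>k. degree (f k)) {1..n}"
  shows "is_basis n f (poly_mod.span (f ` {1..n}))"
proof (rule is_basisI)
  fix a k assume "(\<Sum>k=1..n. smult (a k) (f k)) = 0" "k \<in> {1..n}"
  then show "a k = 0"
    using unit_monic_sum_coeffs[OF _ assms(1) assms(2) ring_mod.subspace_single_0] by simp
qed simp

text \<open>A unitriangular change of basis; span and independence are carried through one
  induction.\<close>

lemma triangular_is_basis:
  fixes u v :: "nat \<Rightarrow> 'a::comm_ring_1 poly"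
  assumes indep: "\<And>a k. (\<Sum>k=1..n. smult (a k) (u k)) = 0 \<Longrightarrow> k \<in> {1..n} \<Longrightarrow> a k = 0"
    and tri: "\<And>k. k \<in> {1..n} \<Longrightarrow> v k - u k \<in> poly_mod.span (u ` {1..<k})"
  shows "is_basis n v (poly_mod.span (u ` {1..n}))"
proof -
  have "poly_mod.span (v ` {1..n}) = poly_mod.span (u ` {1..n}) \<and>
      (\<forall>a k. (\<Sum>k=1..n. smult (a k) (v k)) = 0 \<longrightarrow> k \<in> {1..n} \<longrightarrow> a k = 0)"
    using assms
  proof (induction n)
    case (Suc n)
    have indep_n: "a k = 0" if "(\<Sum>k=1..n. smult (a k) (u k)) = 0" "k \<in> {1..n}" for a k
    proof -
      have "(\<Sum>k=1..n. smult ((a(Suc n := 0)) k) (u k)) = (\<Sum>k=1..n. smult (a k) (u k))"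
        by (rule sum.cong) auto
      then have "(\<Sum>k=1..Suc n. smult ((a(Suc n := 0)) k) (u k)) = 0" using that(1) by simp
      from Suc.prems(1)[OF this, of k] that(2) show ?thesis by auto
    qed
    have tri_n: "v k - u k \<in> poly_mod.span (u ` {1..<k})" if "k \<in> {1..n}" for k
      using Suc.prems(2)[of k] that by simp
    have "poly_mod.span (v ` {1..n}) = poly_mod.span (u ` {1..n}) \<and>
        (\<forall>a k. (\<Sum>k=1..n. smult (a k) (v k)) = 0 \<longrightarrow> k \<in> {1..n} \<longrightarrow> a k = 0)"
      by (rule Suc.IH) (fact indep_n tri_n)+
    then have span_n: "poly_mod.span (v ` {1..n}) = poly_mod.span (u ` {1..n})"
      and indep_v: "\<And>a k. (\<Sum>k=1..n. smult (a k) (v k)) = 0 \<Longrightarrow> k \<in> {1..n} \<Longrightarrow> a k = 0"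
      by blast+
    have diff: "v (Suc n) - u (Suc n) \<in> poly_mod.span (u ` {1..n})"
      using Suc.prems(2)[of "Suc n"] by (simp add: atLeastLessThanSuc_atLeastAtMost)
    have interval: "{1..Suc n} = insert (Suc n) {1..n}" by auto
    have "poly_mod.span (insert (v (Suc n)) (v ` {1..n})) =
        poly_mod.span (insert (u (Suc n)) (v ` {1..n}))"
      using diff unfolding span_n[symmetric] by (rule poly_mod.eq_span_insert_eq)
    also have "\<dots> = poly_mod.span (insert (u (Suc n)) (u ` {1..n}))"
      unfolding poly_mod.span_insert span_n ..
    finally have span: "poly_mod.span (v ` {1..Suc n}) = poly_mod.span (u ` {1..Suc n})"
      unfolding interval image_insert .
    have "a k = 0" if a: "(\<Sum>k=1..Suc n. smult (a k) (v k)) = 0" and k: "k \<in> {1..Suc n}" for a k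
    proof -
      \<comment> \<open>Rewritten in terms of \<open>u\<close>, the relation has last coefficient
        \<open>a (Suc n)\<close>, which independence of \<open>u\<close> therefore kills
        first.\<close>
      let ?s = "\<Sum>k=1..n. smult (a k) (v k)"
      have "?s \<in> poly_mod.span (v ` {1..n})"
        by (intro poly_mod.span_sum poly_mod.span_scale poly_mod.span_base imageI)
      then have "?s + smult (a (Suc n)) (v (Suc n) - u (Suc n)) \<in> poly_mod.span (u ` {1..n})"
        unfolding span_n using diff by (intro poly_mod.span_add poly_mod.span_scale)
      then obtain b where
        b: "?s + smult (a (Suc n)) (v (Suc n) - u (Suc n)) = (\<Sum>k=1..n. smult (b k) (u k))"
        unfolding span_image_finite[OF finite_atLeastAtMost] by blast
      have "(\<Sum>k=1..n. smult ((b(Suc n := a (Suc n))) k) (u k)) = (\<Sum>k=1..n. smult (b k) (u k))"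
        by (rule sum.cong) auto
      then have "(\<Sum>k=1..Suc n. smult ((b(Suc n := a (Suc n))) k) (u k)) = 0"
        using a b[symmetric] by (simp add: smult_diff_right)
      from Suc.prems(1)[OF this, of "Suc n"] have top: "a (Suc n) = 0" by simp
      with a have "?s = 0" by simp
      with indep_v top k show ?thesis by (cases "k = Suc n") auto
    qed
    with span show ?case by blast
  qed simp
  then show ?thesis by (intro is_basisI) blast+
qed

lemma (in local_complex_algebra) unit_monic_admissible:
  assumes "\<And>k. k \<in> {1..n} \<Longrightarrow> unit_monic (f k)" "inj_on (\<lambda>k. degree (f k)) {1..n}"
  shows "admissible emb \<mm> n (poly_mod.span (f ` {1..n}))"
  unfolding admissible_def
proof (intro conjI ballI impI)
  let ?E = "poly_mod.span (f ` {1..n})"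
  show "poly_mod.subspace ?E" by simp
  show "\<exists>f. is_basis n f ?E" using unit_monic_is_basis[OF assms] by blast
  fix p q assume pq: "p \<in> ?E" "q \<in> ?E" "reduce emb \<mm> p = reduce emb \<mm> q"
  then have "p - q \<in> ?E" by (intro poly_mod.span_diff)
  then obtain a where a: "p - q = (\<Sum>k=1..n. smult (a k) (f k))"
    unfolding span_image_finite[OF finite_atLeastAtMost] by blast
  have "reduce emb \<mm> (p - q) = 0" using pq(3) by (simp add: reduce.hom_minus)
  then have coeffs: "coeff (\<Sum>k=1..n. smult (a k) (f k)) i \<in> \<mm>" for i
    unfolding reduce_eq_0_iff a by blast
  have "a k \<in> \<mm>" if "k \<in> {1..n}" for k
    by (rule unit_monic_sum_coeffs[OF finite_atLeastAtMost assms ideal coeffs that])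
  then show "p - q \<in> poly_mod.span {smult a h |a h. a \<in> \<mm> \<and> h \<in> ?E}"
    unfolding a by (intro poly_mod.span_sum poly_mod.span_base) (blast intro: poly_mod.span_base)
qed

section \<open>Iterated binary Wronskians\<close>

text \<open>The operator \<open>iter_Wr2 Q j\<close> is a differential operator of order \<open>j\<close> whose coefficients are
  \<open>iter_coeff Q j\<close>. It is a fraction-free version of taking the Wronskian with \<open>j\<close> fixed
  functions.\<close>

primrec iter_Wr2 :: "(nat \<Rightarrow> 'a::comm_ring_1 poly) \<Rightarrow> nat \<Rightarrow> 'a poly \<Rightarrow> 'a poly" where
  "iter_Wr2 Q 0 f = f"
| "iter_Wr2 Q (Suc j) f = Wr2 (Q j) (iter_Wr2 Q j f)"

primrec iter_coeff :: "(nat \<Rightarrow> 'a::comm_ring_1 poly) \<Rightarrow> nat \<Rightarrow> nat \<Rightarrow> 'a poly" where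
  "iter_coeff Q 0 = (\<lambda>i. if i = 0 then 1 else 0)"
| "iter_coeff Q (Suc j) = (\<lambda>i. Q j * formal_deriv (iter_coeff Q j i) +
     Q j * (case i of 0 \<Rightarrow> 0 | Suc i' \<Rightarrow> iter_coeff Q j i') - formal_deriv (Q j) * iter_coeff Q j i)"

lemma iter_coeff_eq_0: "j < i \<Longrightarrow> iter_coeff Q j i = 0"
  by (induction j arbitrary: i) (auto split: nat.splits)

lemma iter_coeff_diag: "iter_coeff Q j j = (\<Prod>k<j. Q k)"
  by (induction j) (auto simp: iter_coeff_eq_0 mult.commute)

text \<open>The common bound \<open>n\<close> lets the operators of all orders below
  \<open>n\<close> form the rows of one square matrix.\<close>

lemma iter_Wr2_eq_sum:
  "j < n \<Longrightarrow> iter_Wr2 Q j f = (\<Sum>i<n. iter_coeff Q j i * (formal_deriv ^^ i) f)"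
proof (induction j)
  case 0
  then have "(\<Sum>i<n. iter_coeff Q 0 i * (formal_deriv ^^ i) f) = (\<Sum>i<n. if i = 0 then f else 0)"
    by (intro sum.cong) auto
  with 0 show ?case by simp
next
  case (Suc j)
  let ?c = "iter_coeff Q j" and ?D = "\<lambda>i. (formal_deriv ^^ i) f"
  let ?s = "\<lambda>i. case i of 0 \<Rightarrow> 0 | Suc i' \<Rightarrow> ?c i'"
  obtain m where m: "n = Suc m" "j < m" using Suc.prems by (cases n) auto
  have IH: "iter_Wr2 Q j f = (\<Sum>i<n. ?c i * ?D i)" using Suc by simp
  \<comment> \<open>Reindexing loses only the term at \<open>m\<close>, whose coefficient vanishes
    since \<open>j < m\<close>.\<close>
  have shift: "(\<Sum>i<n. ?c i * ?D (Suc i)) = (\<Sum>i<n. ?s i * ?D i)"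
    unfolding m(1) sum.lessThan_Suc_shift[of "\<lambda>i. ?s i * ?D i"]
    using m(2) by (simp add: iter_coeff_eq_0)
  have "formal_deriv (iter_Wr2 Q j f) =
      (\<Sum>i<n. formal_deriv (?c i) * ?D i) + (\<Sum>i<n. ?s i * ?D i)"
    unfolding shift[symmetric] by (simp add: IH formal_deriv_sum formal_deriv_mult sum.distrib)
  then have "iter_Wr2 Q (Suc j) f =
      Q j * ((\<Sum>i<n. formal_deriv (?c i) * ?D i) + (\<Sum>i<n. ?s i * ?D i)) -
      formal_deriv (Q j) * (\<Sum>i<n. ?c i * ?D i)"
    by (simp add: Wr2_def IH)
  also have "\<dots> = (\<Sum>i<n. iter_coeff Q (Suc j) i * ?D i)"
    by (simp add: sum_distrib_left distrib_left sum.distrib[symmetric] sum_subtractf[symmetric])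
      (rule sum.cong, simp_all add: algebra_simps)
  finally show ?case .
qed

lemma iter_Wr2_vanish:
  assumes "iter_Wr2 Q k f = Q k" "k < j"
  shows "iter_Wr2 Q j f = 0"
  using assms(2)
proof (induction j)
  case (Suc j)
  then show ?case using assms(1) by (cases "j = k") auto
qed simp

text \<open>Applying the operators to the functions is a product of matrices: the lower triangular
  coefficients times the Wronskian matrix. The result is upper triangular, since
  \<open>Wr2 (Q k) (Q k) = 0\<close> kills all later iterates, and determinants are
  compared.\<close>

lemma Wr_iter_Wr2:
  assumes "\<And>j. j < length fs \<Longrightarrow> iter_Wr2 Q j (fs ! j) = Q j"
  shows "(\<Prod>j<length fs. \<Prod>k<j. Q k) * Wr fs = (\<Prod>j<length fs. Q j)"
proof -
  let ?n = "length fs"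
  let ?C = "mat ?n ?n (\<lambda>(j, i). iter_coeff Q j i)"
  let ?M = "mat ?n ?n (\<lambda>(i, k). (formal_deriv ^^ i) (fs ! k))"
  let ?S = "mat ?n ?n (\<lambda>(j, k). iter_Wr2 Q j (fs ! k))"
  have "?C * ?M = ?S"
    by (rule eq_matI) (auto simp: scalar_prod_def iter_Wr2_eq_sum[of _ ?n] lessThan_atLeast0)
  then have "det ?S = det ?C * det ?M"
    by (metis det_mult mat_carrier)
  moreover have "det ?C = (\<Prod>j<?n. \<Prod>k<j. Q k)"
    by (subst det_lower_triangular[of ?n])
      (auto simp: iter_coeff_eq_0 prod_list_diag_prod iter_coeff_diag lessThan_atLeast0)
  moreover have "det ?S = (\<Prod>j<?n. Q j)"
  proof (subst det_upper_triangular[of _ ?n])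
    show "upper_triangular ?S"
      by (auto simp: upper_triangular_def intro!: iter_Wr2_vanish[OF assms])
    show "prod_list (diag_mat ?S) = (\<Prod>j<?n. Q j)"
      by (auto simp: prod_list_diag_prod lessThan_atLeast0 assms intro!: prod.cong)
  qed simp
  ultimately show ?thesis by (simp add: Wr_def)
qed

section \<open>Chains descending from a polynomial of the tuple\<close>

lemma (in local_complex_algebra) Wr2_descent:
  fixes w v q s :: "'a poly"
  assumes cop: "a * w + b * v = 1"
    and q: "w dvd Wr2 v q" and v: "w dvd Wr2 (formal_deriv w) (s * v)"
  shows "w dvd Wr2 (formal_deriv w) (s * q)"
proof -
  let ?X = "Wr2 (formal_deriv w) (s * q)"
  have "v * ?X = q * Wr2 (formal_deriv w) (s * v) + formal_deriv w * s * Wr2 v q"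
    by (simp add: Wr2_def formal_deriv_mult algebra_simps)
  then have d: "w dvd v * ?X" using q v by simp
  have "?X = w * (a * ?X) + b * (v * ?X)"
    using arg_cong[OF cop, of "\<lambda>r. r * ?X"] by (simp add: algebra_simps)
  with dvd_add[OF dvd_triv_left dvd_mult[OF d]] show ?thesis by metis
qed

locale critical_tuple = local_complex_algebra emb \<mm>
  for emb :: "complex \<Rightarrow> 'a::comm_ring_1" and \<mm> :: "'a set" +
  fixes N :: nat and T :: "nat \<Rightarrow> complex poly" and y :: "nat \<Rightarrow> 'a poly"
  assumes T_nonzero: "j \<le> N \<Longrightarrow> T j \<noteq> 0"
    and y_unit_monic: "i \<le> N + 1 \<Longrightarrow> unit_monic (y i)"
    and y_0: "y 0 = 1"
    and y_rsquarefree: "i \<in> {1..N} \<Longrightarrow> rsquarefree (reduce emb \<mm> (y i))"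
    and y_coprime: "i \<in> {1..N} \<Longrightarrow> coprime (reduce emb \<mm> (y i)) (reduce emb \<mm> (y (Suc i)))"
    and y_dvd: "i \<in> {1..N} \<Longrightarrow>
      y i dvd Wr2 (formal_deriv (y i)) (map_poly emb (T i) * y (i - 1) * y (Suc i))"
begin

definition is_chain :: "nat \<Rightarrow> (nat \<Rightarrow> 'a poly) \<Rightarrow> bool" where
  "is_chain k p \<longleftrightarrow> p k = y k \<and>
     (\<forall>j\<in>{1..<k}. Wr2 (y j) (p j) = map_poly emb (T j) * y (j - 1) * p (Suc j))"

text \<open>Each equation of a chain determines \<open>p j\<close> up to a multiple of \<open>y j\<close>; the condition \<open>\<phi>\<close>
  fixes that multiple.\<close>

lemma chain_exists:
  assumes k: "k \<in> {1..N + 1}"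
    and \<phi>: "\<And>j p. j \<in> {1..<k} \<Longrightarrow> \<exists>c. \<phi> j (p + smult c (y j))"
  shows "\<exists>p. is_chain k p \<and> (\<forall>j\<in>{1..<k}. \<phi> j (p j))"
proof -
  \<comment> \<open>Besides the equations from \<open>j\<close> upwards, \<open>P j\<close> records
    the divisibility that makes the equation at \<open>j - 1\<close> solvable. At
    \<open>j = k\<close> it is the hypothesis on the tuple; the guard \<open>2 \<le> j\<close>
    reflects that chains have no equation at index 0.\<close>
  define P where "P j \<longleftrightarrow> (\<exists>p. p k = y k \<and>
      (\<forall>l\<in>{j..<k}. Wr2 (y l) (p l) = map_poly emb (T l) * y (l - 1) * p (Suc l) \<and> \<phi> l (p l)) \<and>
      (2 \<le> j \<longrightarrow> y (j - 1) dvd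
        Wr2 (formal_deriv (y (j - 1))) (map_poly emb (T (j - 1)) * y (j - 2) * p j)))" for j
  have "P 1"
  proof (rule inc_induct[of 1 k P])
    show "1 \<le> k" using k by simp
    have "y (k - 1) dvd Wr2 (formal_deriv (y (k - 1))) (map_poly emb (T (k - 1)) * y (k - 2) * y k)"
      if "2 \<le> k"
    proof -
      have k1: "k - 1 \<in> {1..N}" "Suc (k - 1) = k" "k - 1 - 1 = k - 2" using that k by auto
      show ?thesis using y_dvd[OF k1(1)] unfolding k1(2,3) .
    qed
    then show "P k" unfolding P_def by (intro exI[of _ y]) auto
  next
    fix j assume j: "1 \<le> j" "j < k" and "P (Suc j)"
    then obtain p where p: "p k = y k"
        "\<forall>l\<in>{Suc j..<k}. Wr2 (y l) (p l) = map_poly emb (T l) * y (l - 1) * p (Suc l) \<and> \<phi> l (p l)"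
        "y j dvd Wr2 (formal_deriv (y j)) (map_poly emb (T j) * y (j - 1) * p (Suc j))"
      unfolding P_def by (auto simp: numeral_2_eq_2)
    have jN: "j \<in> {1..N}" using j k by simp
    then have y: "unit_monic (y j)" using y_unit_monic by simp
    obtain a b where "a * y j + b * formal_deriv (y j) = 1"
      using rsquarefree_lift[OF y y_rsquarefree[OF jN]] by blast
    from Wr2_solvable[OF y this p(3)] obtain r
      where r: "Wr2 (y j) r = map_poly emb (T j) * y (j - 1) * p (Suc j)" by blast
    obtain c where c: "\<phi> j (r + smult c (y j))" using \<phi>[of j r] j by auto
    define p' where "p' = p(j := r + smult c (y j))"
    have eq: "Wr2 (y j) (p' j) = map_poly emb (T j) * y (j - 1) * p (Suc j)"
      by (simp add: p'_def Wr2_add_right Wr2_smult_right r)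
    \<comment> \<open>Descent with \<open>w = y (j - 1)\<close>, \<open>v = y j\<close>,
      \<open>q = p' j\<close>: the equation at \<open>j\<close> has \<open>y (j - 1)\<close> as a
      factor on its right-hand side.\<close>
    have "y (j - 1) dvd
        Wr2 (formal_deriv (y (j - 1))) (map_poly emb (T (j - 1)) * y (j - 2) * p' j)" if "2 \<le> j"
    proof -
      have j1: "j - 1 \<in> {1..N}" "Suc (j - 1) = j" "j - 1 - 1 = j - 2" using that jN by auto
      have "unit_monic (y (j - 1))" using y_unit_monic j1 by simp
      then obtain a b where "a * y (j - 1) + b * y j = 1"
        using coprime_lift y_coprime[OF j1(1)] unfolding j1(2) by blast
      moreover have "y (j - 1) dvd Wr2 (y j) (p' j)"
        unfolding eq by (simp add: mult.assoc mult.left_commute[of _ "y (j - 1)"])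
      moreover have "y (j - 1) dvd
          Wr2 (formal_deriv (y (j - 1))) (map_poly emb (T (j - 1)) * y (j - 2) * y j)"
        using y_dvd[OF j1(1)] unfolding j1(2,3) .
      ultimately show ?thesis by (rule Wr2_descent)
    qed
    moreover have "\<forall>l\<in>{j..<k}. Wr2 (y l) (p' l) = map_poly emb (T l) * y (l - 1) * p' (Suc l) \<and>
        \<phi> l (p' l)"
    proof
      fix l assume l: "l \<in> {j..<k}"
      show "Wr2 (y l) (p' l) = map_poly emb (T l) * y (l - 1) * p' (Suc l) \<and> \<phi> l (p' l)"
      proof (cases "l = j")
        case True
        then show ?thesis using eq c by (simp add: p'_def)
      next
        case False
        then show ?thesis using p(2) l by (simp add: p'_def)
      qed
    qed
    moreover have "p' k = y k" using p(1) j by (simp add: p'_def)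
    ultimately show "P j" unfolding P_def by blast
  qed
  then show ?thesis unfolding P_def is_chain_def by auto
qed

text \<open>Downward induction on the index. By linearity the two sides solve the same equation at
  \<open>i\<close>, so they differ by a multiple of \<open>y i = U i i\<close>, which supplies the
  new summand \<open>l = i\<close>.\<close>

lemma chain_difference:
  assumes k: "k \<in> {1..N + 1}" and q: "is_chain k q"
    and U: "\<And>l. l \<in> {1..k} \<Longrightarrow> is_chain l (U l)" and j: "j \<in> {1..k}"
  shows "\<exists>a. q j = U k j + (\<Sum>l=j..<k. smult (a l) (U l j))"
proof -
  have "j \<le> k" using j by simp
  then show ?thesis
  proof (rule inc_induct[of j k])
    show "\<exists>a. q k = U k k + (\<Sum>l=k..<k. smult (a l) (U l k))"
      using q U[of k] k by (simp add: is_chain_def)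
  next
    fix i assume i: "j \<le> i" "i < k"
      and "\<exists>a. q (Suc i) = U k (Suc i) + (\<Sum>l=Suc i..<k. smult (a l) (U l (Suc i)))"
    then obtain a where a: "q (Suc i) = U k (Suc i) + (\<Sum>l=Suc i..<k. smult (a l) (U l (Suc i)))"
      by blast
    have i1: "1 \<le> i" "i \<in> {1..<k}" using i j by auto
    let ?r = "map_poly emb (T i) * y (i - 1)"
    have U_eq: "Wr2 (y i) (U l i) = ?r * U l (Suc i)" if "l \<in> {Suc i..k}" for l
      using U[of l] that i1 by (auto simp: is_chain_def)
    let ?d = "q i - (U k i + (\<Sum>l=Suc i..<k. smult (a l) (U l i)))"
    have "Wr2 (y i) (\<Sum>l=Suc i..<k. smult (a l) (U l i)) =
        (\<Sum>l=Suc i..<k. ?r * smult (a l) (U l (Suc i)))"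
      unfolding Wr2_sum_right by (rule sum.cong) (auto simp: Wr2_smult_right U_eq)
    moreover have "Wr2 (y i) (q i) = ?r * q (Suc i)" using q i1 by (simp add: is_chain_def)
    ultimately have "Wr2 (y i) ?d = 0"
      using U_eq[of k] i
      by (simp add: Wr2_diff_right Wr2_add_right a distrib_left sum_distrib_left)
    then obtain c where c: "?d = smult c (y i)"
      using Wr2_eq_0 y_unit_monic[of i] k i by fastforce
    have "U i i = y i" using U[of i] i1 by (auto simp: is_chain_def)
    let ?a = "a(i := c)"
    have "(\<Sum>l=i..<k. smult (?a l) (U l i)) =
        smult c (y i) + (\<Sum>l=Suc i..<k. smult (?a l) (U l i))"
      using i \<open>U i i = y i\<close> by (subst sum.atLeast_Suc_lessThan) auto
    also have "(\<Sum>l=Suc i..<k. smult (?a l) (U l i)) = (\<Sum>l=Suc i..<k. smult (a l) (U l i))"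
      by (rule sum.cong) auto
    finally have "q i = U k i + (\<Sum>l=i..<k. smult (?a l) (U l i))"
      using c by (simp add: algebra_simps)
    then show "\<exists>a. q i = U k i + (\<Sum>l=i..<k. smult (a l) (U l i))"
      by (rule exI[where x = ?a])
  qed
qed

text \<open>Each equation gives \<open>degree (y i) + degree (p i) = 1 + degree (T i) + degree (y (i
  - 1)) + degree (p (Suc i))\<close>, which telescopes from \<open>p k = y k\<close>. The case
  \<open>j = 1\<close> yields the degree of the generator, and the inequality yields distinct
  exponents.\<close>

lemma chain_degree:
  assumes k: "k \<in> {1..N + 1}" and p: "is_chain k p"
    and normal: "\<And>j. j \<in> {1..<k} \<Longrightarrow> coeff (p j) (degree (y j)) = 0" and j: "j \<in> {1..k}"
  shows "unit_monic (p j)"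
    and "int (degree (p j)) =
      c_exp T y k - (int j - 1 + (\<Sum>l<j. int (degree (T l)))) + int (degree (y (j - 1)))"
    and "j < k \<Longrightarrow> degree (p j) \<noteq> degree (y j)"
proof -
  let ?P = "\<lambda>j. unit_monic (p j) \<and> int (degree (p j)) =
      c_exp T y k - (int j - 1 + (\<Sum>l<j. int (degree (T l)))) + int (degree (y (j - 1)))"
  have step: "?P i \<and> degree (p i) \<noteq> degree (y i)" if i: "i \<in> {1..<k}" and IH: "?P (Suc i)" for i
  proof -
    have eq: "Wr2 (y i) (p i) = map_poly emb (T i) * (y (i - 1) * p (Suc i))"
      using p i by (simp add: is_chain_def mult.assoc)
    have T: "unit_monic (map_poly emb (T i))" using unit_monic_emb T_nonzero i k by simp
    have y: "unit_monic (y i)" "unit_monic (y (i - 1))" using y_unit_monic i k by auto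
    have yp: "unit_monic (y (i - 1) * p (Suc i))" using y IH by (simp add: unit_monic_mult)
    have W: "unit_monic (Wr2 (y i) (p i))" unfolding eq by (rule unit_monic_mult[OF T yp])
    have "degree (Wr2 (y i) (p i)) = degree (T i) + (degree (y (i - 1)) + degree (p (Suc i)))"
      unfolding eq using T yp y IH
      by (simp add: degree_unit_monic_mult unit_monic_nonzero degree_emb)
    then show ?thesis
      using Wr2_unit_monic[OF y(1) W normal[OF i]] i IH by auto
  qed
  have P: "?P j"
  proof (rule inc_induct[of j k ?P])
    show "j \<le> k" using j by simp
    have "p k = y k" using p by (simp add: is_chain_def)
    then show "?P k" using y_unit_monic k by (simp add: c_exp_def)
    fix i assume "j \<le> i" "i < k" "?P (Suc i)"
    then show "?P i" using step[of i] j by auto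
  qed
  then show "unit_monic (p j)" and "int (degree (p j)) =
      c_exp T y k - (int j - 1 + (\<Sum>l<j. int (degree (T l)))) + int (degree (y (j - 1)))" by auto
  assume "j < k"
  \<comment> \<open>The induction is repeated down to \<open>Suc j\<close> because the degree
    inequality comes out of the step from \<open>Suc j\<close> to \<open>j\<close>.\<close>
  have "?P (Suc j)"
  proof (rule inc_induct[of "Suc j" k ?P])
    show "Suc j \<le> k" using \<open>j < k\<close> by simp
    have "p k = y k" using p by (simp add: is_chain_def)
    then show "?P k" using y_unit_monic k by (simp add: c_exp_def)
    fix i assume "Suc j \<le> i" "i < k" "?P (Suc i)"
    then show "?P i" using step[of i] by auto
  qed
  then show "degree (p j) \<noteq> degree (y j)" using step[of j] j \<open>j < k\<close> by auto
qed

lemma T_local_factor: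
  assumes "j \<le> N"
  shows "\<exists>h. map_poly emb (T j) = [:- emb z, 1:] ^ order z (T j) * h \<and> poly h (emb z) dvd 1"
proof -
  obtain h where h: "T j = [:- z, 1:] ^ order z (T j) * h" "\<not> [:- z, 1:] dvd h"
    using order_decomp[OF T_nonzero[OF assms]] by blast
  have "map_poly emb [:- z, 1:] = [:- emb z, 1:]"
    by (simp add: hom_uminus map_poly_pCons_hom)
  then have "map_poly emb (T j) = [:- emb z, 1:] ^ order z (T j) * map_poly emb h"
    by (subst h(1)) (simp add: emb_poly.hom_mult emb_poly.hom_power)
  moreover have "poly (map_poly emb h) (emb z) dvd 1"
    using h(2) by (simp add: unit_iff_residue poly_eq_0_iff_dvd)
  ultimately show ?thesis by blast
qed

text \<open>Going down by one index multiplies the right-hand side by \<open>T i\<close>, and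
  integrating with value zero at \<open>z\<close> adds one more order of vanishing.\<close>

lemma chain_local_factor:
  assumes k: "k \<in> {1..N + 1}" and p: "is_chain k p"
    and normal: "\<And>j. j \<in> {1..<k} \<Longrightarrow> poly (p j) (emb z) = 0"
    and y_z: "\<And>i. i \<le> N + 1 \<Longrightarrow> poly (y i) (emb z) dvd 1" and j: "j \<in> {1..k}"
  shows "\<exists>g. p j = [:- emb z, 1:] ^ (\<Sum>l=j..<k. Suc (order z (T l))) * g \<and> poly g (emb z) dvd 1"
proof -
  have "j \<le> k" using j by simp
  then show ?thesis
  proof (rule inc_induct[of j k])
    have "p k = y k" using p by (simp add: is_chain_def)
    then show "\<exists>g. p k = [:- emb z, 1:] ^ (\<Sum>l=k..<k. Suc (order z (T l))) * g \<and>
        poly g (emb z) dvd 1"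
      using y_z[of k] k by simp
  next
    fix i assume i: "j \<le> i" "i < k"
      and "\<exists>g. p (Suc i) = [:- emb z, 1:] ^ (\<Sum>l=Suc i..<k. Suc (order z (T l))) * g \<and>
        poly g (emb z) dvd 1"
    then obtain g where g: "p (Suc i) = [:- emb z, 1:] ^ (\<Sum>l=Suc i..<k. Suc (order z (T l))) * g"
      "poly g (emb z) dvd 1" by blast
    have i1: "i \<in> {1..<k}" using i j by auto
    obtain h where h: "map_poly emb (T i) = [:- emb z, 1:] ^ order z (T i) * h"
      "poly h (emb z) dvd 1" using T_local_factor[of i z] i k by auto
    have "Wr2 (y i) (p i) = map_poly emb (T i) * y (i - 1) * p (Suc i)"
      using p i1 by (simp add: is_chain_def)
    also have "\<dots> = [:- emb z, 1:] ^ (order z (T i) + (\<Sum>l=Suc i..<k. Suc (order z (T l)))) *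
        (h * y (i - 1) * g)"
      unfolding g(1) h(1) by (simp only: power_add mult_ac)
    finally have W: "Wr2 (y i) (p i) = \<dots>" .
    have "poly (h * y (i - 1) * g) (emb z) dvd 1"
      using mult_dvd_mono[OF mult_dvd_mono[OF h(2) y_z[of "i - 1"]] g(2)] i k by simp
    from Wr2_root_order[OF y_z[of i] W this normal[OF i1]] i k obtain q
      where "p i = [:- emb z, 1:] ^ Suc (order z (T i) + (\<Sum>l=Suc i..<k. Suc (order z (T l)))) * q"
        "poly q (emb z) dvd 1" by auto
    moreover have "(\<Sum>l=i..<k. Suc (order z (T l))) =
        Suc (order z (T i) + (\<Sum>l=Suc i..<k. Suc (order z (T l))))"
      using i by (subst sum.atLeast_Suc_lessThan) auto
    ultimately show "\<exists>g. p i = [:- emb z, 1:] ^ (\<Sum>l=i..<k. Suc (order z (T l))) * g \<and>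
        poly g (emb z) dvd 1" by auto
  qed
qed

section \<open>The Wronskian determinant of the generators\<close>

lemma K_poly_Suc: "K_poly T (Suc i) = K_poly T i * (\<Prod>j\<le>i. T j)"
proof -
  have "K_poly T (Suc i) = (\<Prod>j<i. T j ^ Suc (i - j)) * T i"
    unfolding K_poly_def by (simp add: Suc_diff_le less_imp_le)
  also have "\<dots> = (\<Prod>j<i. T j ^ (i - j)) * ((\<Prod>j<i. T j) * T i)"
    by (simp add: prod.distrib mult_ac)
  also have "(\<Prod>j<i. T j) * T i = (\<Prod>j\<le>i. T j)"
    by (simp flip: lessThan_Suc_atMost)
  finally show ?thesis by (simp add: K_poly_def)
qed

text \<open>The factor accumulated by iterated Wronskians along a chain. It is the same for all
  chains: the square comes from \<open>Wr2_mult_both\<close>, the rest from the chain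
  equation.\<close>

primrec iter_factor :: "nat \<Rightarrow> 'a poly" where
  "iter_factor 0 = map_poly emb (T 0)"
| "iter_factor (Suc j) = (iter_factor j)\<^sup>2 * map_poly emb (T (Suc j)) * y j"

lemma iter_Wr2_chain:
  assumes "is_chain k p" "j < k"
  shows "iter_Wr2 (\<lambda>j. iter_factor j * y (Suc j)) j (map_poly emb (T 0) * p 1) =
    iter_factor j * p (Suc j)"
  using assms(2)
proof (induction j)
  case (Suc j)
  then have "Wr2 (y (Suc j)) (p (Suc j)) = map_poly emb (T (Suc j)) * y j * p (Suc (Suc j))"
    using assms(1) by (simp add: is_chain_def)
  then have "Wr2 (iter_factor j * y (Suc j)) (iter_factor j * p (Suc j)) =
      iter_factor (Suc j) * p (Suc (Suc j))"
    unfolding Wr2_mult_both by (simp add: mult_ac)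
  with Suc show ?case by simp
qed simp

text \<open>Unrolls the squares of the recursion into the products by which the triangular
  coefficient matrix contributes, so that these can be cancelled.\<close>

lemma iter_factor_eq:
  "iter_factor i * y i = map_poly emb (\<Prod>l\<le>i. T l) * (\<Prod>k<i. iter_factor k * y (Suc k))"
proof (induction i)
  case (Suc i)
  have "iter_factor (Suc i) * y (Suc i) =
      (iter_factor i * y (Suc i)) * map_poly emb (T (Suc i)) * (iter_factor i * y i)"
    by (simp add: power2_eq_square mult_ac)
  also have "\<dots> = map_poly emb (\<Prod>l\<le>Suc i. T l) * (\<Prod>k<Suc i. iter_factor k * y (Suc k))"
    unfolding Suc by (simp add: emb_poly.hom_mult mult_ac)
  finally show ?case .
qed (simp add: y_0)

lemma prod_iter_factor:
  "(\<Prod>j<i. iter_factor j * y (Suc j)) =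
    (\<Prod>j<i. \<Prod>k<j. iter_factor k * y (Suc k)) * (map_poly emb (K_poly T i) * y i)"
proof (induction i)
  case 0
  then show ?case by (simp add: K_poly_def y_0)
next
  case (Suc i)
  let ?Q = "\<lambda>j. iter_factor j * y (Suc j)" and ?K = "\<lambda>i. map_poly emb (K_poly T i)"
  have "(\<Prod>j<Suc i. ?Q j) = (\<Prod>j<i. \<Prod>k<j. ?Q k) * ?K i * y (Suc i) * (iter_factor i * y i)"
    using Suc by (simp add: mult_ac)
  also have "\<dots> = (\<Prod>j<Suc i. \<Prod>k<j. ?Q k) * (?K (Suc i) * y (Suc i))"
    unfolding iter_factor_eq K_poly_Suc by (simp add: emb_poly.hom_mult mult_ac)
  finally show ?case .
qed

lemma unit_monic_iter_factor: "j \<le> N \<Longrightarrow> unit_monic (iter_factor j)"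
  by (induction j)
    (auto intro!: unit_monic_mult unit_monic_power unit_monic_emb T_nonzero y_unit_monic)

text \<open>The chain for \<open>k\<close> ends in \<open>y k\<close>, so the iterated Wronskian of
  order \<open>k - 1\<close> takes its generator to \<open>?Q (k - 1)\<close>, as
  \<open>Wr_iter_Wr2\<close> requires. The double product has a unit leading coefficient and
  cancels.\<close>

lemma Wr_chains:
  assumes U: "\<And>k. k \<in> {1..i} \<Longrightarrow> is_chain k (U k)" and i: "i \<in> {1..N + 1}"
  shows "Wr (map (\<lambda>k. map_poly emb (T 0) * U k 1) [1..<i + 1]) = map_poly emb (K_poly T i) * y i"
proof -
  let ?u = "\<lambda>k. map_poly emb (T 0) * U k 1" and ?Q = "\<lambda>j. iter_factor j * y (Suc j)"
  let ?fs = "map ?u [1..<i + 1]"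
  have len: "length ?fs = i" by simp
  have "iter_Wr2 ?Q j (?fs ! j) = ?Q j" if "j < length ?fs" for j
  proof -
    have j: "j < i" "?fs ! j = ?u (Suc j)" using that by (simp_all del: upt_Suc)
    have "is_chain (Suc j) (U (Suc j))" using U j(1) by simp
    with iter_Wr2_chain[OF this, of j] show ?thesis unfolding j(2) by (simp add: is_chain_def)
  qed
  from Wr_iter_Wr2[of ?fs ?Q, OF this]
  have "(\<Prod>j<i. \<Prod>k<j. ?Q k) * Wr ?fs = (\<Prod>j<i. \<Prod>k<j. ?Q k) * (map_poly emb (K_poly T i) * y i)"
    unfolding len prod_iter_factor[symmetric] .
  moreover have "unit_monic (\<Prod>j<i. \<Prod>k<j. ?Q k)"
    using i by (intro unit_monic_prod unit_monic_mult unit_monic_iter_factor y_unit_monic) auto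
  ultimately show ?thesis by (rule unit_monic_cancel[rotated])
qed

section \<open>Normalised chains and the flag with its exponents\<close>

lemma chain_normal_at_infinity:
  assumes "k \<in> {1..N + 1}"
  shows "\<exists>p. is_chain k p \<and> (\<forall>j\<in>{1..<k}. coeff (p j) (degree (y j)) = 0)"
proof (rule chain_exists[OF assms])
  fix j p assume "j \<in> {1..<k}"
  then have "unit_monic (y j)" using y_unit_monic assms by simp
  then obtain v where "1 = lead_coeff (y j) * v" unfolding unit_monic_def by (elim dvdE)
  then have "v * coeff p (degree (y j)) * lead_coeff (y j) = coeff p (degree (y j))"
    by (metis mult.assoc mult.commute mult_1)
  then show "\<exists>c. coeff (p + smult c (y j)) (degree (y j)) = 0"
    by (intro exI[of _ "- (v * coeff p (degree (y j)))"]) simp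
qed

lemma chain_normal_at:
  assumes "k \<in> {1..N + 1}" and y_z: "\<And>i. i \<le> N + 1 \<Longrightarrow> poly (y i) (emb z) dvd 1"
  shows "\<exists>p. is_chain k p \<and> (\<forall>j\<in>{1..<k}. poly (p j) (emb z) = 0)"
proof (rule chain_exists[OF assms(1)])
  fix j p assume "j \<in> {1..<k}"
  then have "poly (y j) (emb z) dvd 1" using y_z assms(1) by simp
  then obtain v where "1 = poly (y j) (emb z) * v" by (elim dvdE)
  then have "v * poly p (emb z) * poly (y j) (emb z) = poly p (emb z)"
    by (metis mult.assoc mult.commute mult_1)
  then show "\<exists>c. poly (p + smult c (y j)) (emb z) = 0"
    by (intro exI[of _ "- (v * poly p (emb z))"]) simp
qed

text \<open>One flag, built from chains normalised at infinity, serves all points. Its own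
  generators exhibit the exponents at infinity; at \<open>z\<close> each is corrected by earlier
  ones so as to come from a chain vanishing at \<open>z\<close>.\<close>

theorem exists_flag:
  assumes y_z: "\<And>i z. i \<le> N + 1 \<Longrightarrow> z \<in> singular_points N T \<Longrightarrow> poly (y i) (emb z) dvd 1"
  shows "\<exists>u :: nat \<Rightarrow> 'a poly. \<forall>i\<in>{1..N + 1}.
     (let E = poly_mod.span (u ` {1..i}) in
        Wr (map u [1..<i + 1]) = map_poly emb (K_poly T i) * y i \<and>
        admissible emb \<mm> i E \<and>
        (\<forall>z\<in>singular_points N T. exponents_at emb \<mm> i E z (e_exp T z ` {1..i})) \<and>
        (\<exists>B. exponents_at_infinity emb \<mm> i E B \<and> int ` B = c_exp T y ` {1..i}))"
proof -
  obtain U where U: "\<And>k. k \<in> {1..N + 1} \<Longrightarrow> is_chain k (U k)"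
    and normal: "\<And>k j. k \<in> {1..N + 1} \<Longrightarrow> j \<in> {1..<k} \<Longrightarrow> coeff (U k j) (degree (y j)) = 0"
    using chain_normal_at_infinity by metis
  define u where "u = (\<lambda>k. map_poly emb (T 0) * U k 1)"
  have T0: "unit_monic (map_poly emb (T 0))" using unit_monic_emb T_nonzero by simp
  have U1: "unit_monic (U k 1)" if "k \<in> {1..N + 1}" for k
    using chain_degree(1)[OF that U[OF that] normal[OF that]] that by simp
  have u: "unit_monic (u k)" if "k \<in> {1..N + 1}" for k
    unfolding u_def by (rule unit_monic_mult[OF T0 U1[OF that]])
  have deg_u: "int (degree (u k)) = c_exp T y k" if "k \<in> {1..N + 1}" for k
  proof -
    have "degree (u k) = degree (T 0) + degree (U k 1)"
      unfolding u_def
      using degree_unit_monic_mult[OF T0 unit_monic_nonzero[OF U1[OF that]]] by (simp add: degree_emb)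
    then show ?thesis
      using chain_degree(2)[OF that U[OF that] normal[OF that], of 1] that by (simp add: y_0)
  qed
  \<comment> \<open>By the degree formula, \<open>degree (U k j) \<noteq> degree (y j)\<close> is
    this inequality with both sides shifted equally.\<close>
  have c_neq: "c_exp T y j \<noteq> c_exp T y k" if "k \<in> {1..N + 1}" "j \<in> {1..<k}" for j k
    using chain_degree(2,3)[OF that(1) U[OF that(1)] normal[OF that(1)], of j] that
    by (auto simp: c_exp_def[of T y j])
  have inj: "inj_on (\<lambda>k. degree (u k)) {1..i}" if "i \<in> {1..N + 1}" for i
  proof (rule inj_onI)
    fix j k assume jk: "j \<in> {1..i}" "k \<in> {1..i}" "degree (u j) = degree (u k)"
    then have "c_exp T y j = c_exp T y k"
      using deg_u[of j] deg_u[of k] that by simp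
    then show "j = k"
      using c_neq[of j k] c_neq[of k j] jk that by (cases j k rule: linorder_cases) auto
  qed
  show ?thesis
  proof (intro exI[of _ u] ballI, unfold Let_def, intro conjI ballI)
    fix i assume i: "i \<in> {1..N + 1}"
    let ?E = "poly_mod.span (u ` {1..i})"
    have u_i: "unit_monic (u k)" if "k \<in> {1..i}" for k using u that i by simp
    show "Wr (map u [1..<i + 1]) = map_poly emb (K_poly T i) * y i"
      unfolding u_def using U i by (intro Wr_chains) auto
    show adm: "admissible emb \<mm> i ?E"
      using u_i inj[OF i] by (rule unit_monic_admissible)
    show "\<exists>B. exponents_at_infinity emb \<mm> i ?E B \<and> int ` B = c_exp T y ` {1..i}"
    proof (intro exI conjI)
      show "exponents_at_infinity emb \<mm> i ?E ((\<lambda>k. degree (u k)) ` {1..i})"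
        unfolding exponents_at_infinity_def
        using adm inj[OF i] unit_monic_is_basis[OF u_i inj[OF i]] u_i by blast
      show "int ` (\<lambda>k. degree (u k)) ` {1..i} = c_exp T y ` {1..i}"
        unfolding image_image using deg_u i by (intro image_cong) auto
    qed
    fix z assume z: "z \<in> singular_points N T"
    note y_z = y_z[OF _ z]
    have "\<exists>v g. v - u k \<in> poly_mod.span (u ` {1..<k}) \<and>
        v = [:- emb z, 1:] ^ e_exp T z k * g \<and> poly g (emb z) dvd 1" if k: "k \<in> {1..i}" for k
    proof -
      have kN: "k \<in> {1..N + 1}" using k i by simp
      obtain q where q: "is_chain k q" "\<forall>j\<in>{1..<k}. poly (q j) (emb z) = 0"
        using chain_normal_at[OF kN y_z] by blast
      obtain g where g: "q 1 = [:- emb z, 1:] ^ (\<Sum>l=1..<k. Suc (order z (T l))) * g"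
        "poly g (emb z) dvd 1"
        using chain_local_factor[OF kN q(1) _ y_z, of 1] q(2) kN by auto
      obtain h where h: "map_poly emb (T 0) = [:- emb z, 1:] ^ order z (T 0) * h"
        "poly h (emb z) dvd 1" using T_local_factor[of 0 z] by auto
      \<comment> \<open>The \<open>k - 1\<close> integrations contribute one order each;
        \<open>T 0\<close> enters without an integration.\<close>
      have "e_exp T z k = order z (T 0) + (\<Sum>l=1..<k. Suc (order z (T l)))"
      proof -
        have "(\<Sum>l<k. order z (T l)) = order z (T 0) + (\<Sum>l=1..<k. order z (T l))"
          using k by (simp add: lessThan_atLeast0 sum.atLeast_Suc_lessThan)
        moreover have "(\<Sum>l=1..<k. Suc (order z (T l))) = k - 1 + (\<Sum>l=1..<k. order z (T l))"
          unfolding Suc_eq_plus1_left sum.distrib by simp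
        ultimately show ?thesis by (simp only: e_exp_def)
      qed
      then have "map_poly emb (T 0) * q 1 = [:- emb z, 1:] ^ e_exp T z k * (h * g)"
        unfolding g(1) h(1) by (simp only: power_add mult_ac)
      moreover have "poly (h * g) (emb z) dvd 1"
        using mult_dvd_mono[OF h(2) g(2)] by simp
      \<comment> \<open>The two normalisations differ only by chains of smaller index, which gives
        the triangular shape.\<close>
      moreover obtain a where "q 1 = U k 1 + (\<Sum>l=1..<k. smult (a l) (U l 1))"
        using chain_difference[OF kN q(1) U, of 1] kN by auto
      then have "map_poly emb (T 0) * q 1 - u k = (\<Sum>l=1..<k. smult (a l) (u l))"
        by (simp add: u_def distrib_left sum_distrib_left)
      then have "map_poly emb (T 0) * q 1 - u k \<in> poly_mod.span (u ` {1..<k})"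
        by (simp only:) (intro poly_mod.span_sum poly_mod.span_scale poly_mod.span_base imageI)
      ultimately show ?thesis by blast
    qed
    then obtain v g where v: "\<And>k. k \<in> {1..i} \<Longrightarrow> v k - u k \<in> poly_mod.span (u ` {1..<k})"
      and g: "\<And>k. k \<in> {1..i} \<Longrightarrow> v k = [:- emb z, 1:] ^ e_exp T z k * g k"
        "\<And>k. k \<in> {1..i} \<Longrightarrow> poly (g k) (emb z) dvd 1"
      by metis
    show "exponents_at emb \<mm> i ?E z (e_exp T z ` {1..i})"
      unfolding exponents_at_def
    proof (intro conjI adm exI[of _ "e_exp T z"] exI[of _ g] ballI refl)
      show "inj_on (e_exp T z) {1..i}"
      proof (rule strict_mono_on_imp_inj_on, rule strict_mono_onI)
        fix j k assume "j \<in> {1..i}" "k \<in> {1..i}" "j < k"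
        moreover have "(\<Sum>l<j. order z (T l)) \<le> (\<Sum>l<k. order z (T l))"
          using \<open>j < k\<close> by (intro sum_mono2) auto
        ultimately show "e_exp T z j < e_exp T z k" by (simp add: e_exp_def)
      qed
      have "is_basis i v ?E"
      proof (rule triangular_is_basis)
        fix a k assume "(\<Sum>k=1..i. smult (a k) (u k)) = 0" "k \<in> {1..i}"
        then show "a k = 0"
          using unit_monic_sum_coeffs[OF _ u_i inj[OF i] ring_mod.subspace_single_0] by simp
      qed (rule v)
      \<comment> \<open>\<open>is_basis\<close> depends only on the values on \<open>{1..i}\<close>,
        where both families agree.\<close>
      moreover have "(\<lambda>j. [:- emb z, 1:] ^ e_exp T z j * g j) ` {1..i} = v ` {1..i}"
        by (rule image_cong[OF refl g(1)[symmetric]])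
      moreover have "inj_on (\<lambda>j. [:- emb z, 1:] ^ e_exp T z j * g j) {1..i} \<longleftrightarrow> inj_on v {1..i}"
        by (rule inj_on_cong[OF g(1)[symmetric]])
      ultimately show "is_basis i (\<lambda>j. [:- emb z, 1:] ^ e_exp T z j * g j) ?E"
        unfolding is_basis_def by (simp only: simp_thms)
      show "poly (g j) (emb z) dvd 1" if "j \<in> {1..i}" for j
        using g(2)[OF that] .
    qed
  qed
qed

end

theorem theorem2p5:
  fixes emb :: "complex \<Rightarrow> 'a::comm_ring_1"
    and \<mm> :: "'a set"
    and N :: nat
    and T :: "nat \<Rightarrow> complex poly"
    and y :: "nat \<Rightarrow> 'a poly"
  assumes "local_complex_algebra emb \<mm>"
    and "N \<ge> 1"
    and "\<forall>j\<in>{0..N}. T j \<noteq> 0"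
    and "\<forall>i\<in>{1..N}. unit_monic (y i)"
    and "y 0 = 1" and "y (N + 1) = 1"
    and "\<forall>i\<in>{1..N}. rsquarefree (reduce emb \<mm> (y i))"
    and "\<forall>i\<in>{1..N}. \<forall>z\<in>singular_points N T. poly (reduce emb \<mm> (y i)) z \<noteq> 0"
    and "\<forall>i\<in>{1..N}. coprime (reduce emb \<mm> (y i)) (reduce emb \<mm> (y (i + 1)))"
    and "\<forall>i\<in>{1..N}. y i dvd
           Wr [formal_deriv (y i), map_poly emb (T i) * y (i - 1) * y (i + 1)]"
  shows "\<exists>u :: nat \<Rightarrow> 'a poly. \<forall>i\<in>{1..N + 1}.
     (let E = poly_mod.span (u ` {1..i}) in
        Wr (map u [1..<i + 1]) = map_poly emb (K_poly T i) * y i \<and>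
        admissible emb \<mm> i E \<and>
        (\<forall>z\<in>singular_points N T. exponents_at emb \<mm> i E z (e_exp T z ` {1..i})) \<and>
        (\<exists>B. exponents_at_infinity emb \<mm> i E B \<and> int ` B = c_exp T y ` {1..i}))"
proof -
  interpret local_complex_algebra emb \<mm> by fact
  have range: "i = 0 \<or> i = N + 1 \<or> i \<in> {1..N}" if "i \<le> N + 1" for i
    using that by auto
  interpret critical_tuple emb \<mm> N T y
  proof
    show "unit_monic (y i)" if "i \<le> N + 1" for i
      using range[OF that] assms(4,5,6) by auto
  qed (use assms in \<open>auto simp: Wr_pair\<close>)
  show ?thesis
  proof (rule exists_flag)
    fix i z assume "i \<le> N + 1" "z \<in> singular_points N T"
    \<comment> \<open>A value at \<open>emb z\<close> is a unit if and only if the reduction does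
      not vanish at \<open>z\<close>; at the two ends the polynomial is 1.\<close>
    with range[of i] assms(5,6,8) show "poly (y i) (emb z) dvd 1"
      by (auto simp: unit_iff_residue poly_reduce)
  qed
qed

end
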